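(* Let $\Phi\in\mathcal T$. If $\Phi(S)=0$ for every split graph $S$, then $\Phi(G)=0$ for every graph $G$.
   Context: All graphs are finite, simple, and nonempty. A graph is split if its vertex set is the disjoint union of a clique and an independent set (either possibly empty). For a graph $G$ with complement $\overline G$ and a nonempty binary word $\beta=(\beta_1,\ldots,\beta_k)\in\{0,1\}^k$, put $M_1(G):=A(G)$ (the adjacency matrix of $G$), $M_0(G):=A(\overline G)$, and $n_\beta(G):=\operatorname{tr}(M_{\beta_1}(G)\cdots M_{\beta_k}(G))$. $\mathcal T:=\operatorname{span}_{\mathbb R}\{n_\beta:\beta\text{ is a nonempty binary word}\}$ is the space of all finite real linear combinations of the graph parameters $G\mapsto n_\beta(G)$. *)

theory Defs
  imports
    Complex_Main
    "HOL-Library.Function_Algebras"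
    "HOL-Library.Infinite_Typeclass"
    "Graph_Theory.Pair_Digraph"
begin

text \<open>
  The locale \<open>pair_graph\<close> describes the finite simple graphs: a finite vertex set and a symmetric,
  irreflexive edge relation on it.
\<close>

definition nonempty_graph :: "'a pair_pre_digraph \<Rightarrow> bool" where
  "nonempty_graph G \<longleftrightarrow> pair_graph G \<and> pverts G \<noteq> {}"

definition graph_complement :: "'a pair_pre_digraph \<Rightarrow> 'a pair_pre_digraph" where
  "graph_complement G =
     \<lparr>pverts = pverts G,
      parcs = {(u, v). u \<in> pverts G \<and> v \<in> pverts G \<and> u \<noteq> v \<and> (u, v) \<notin> parcs G}\<rparr>"

definition is_clique :: "'a pair_pre_digraph \<Rightarrow> 'a set \<Rightarrow> bool" where
  "is_clique G K \<longleftrightarrow> K \<subseteq> pverts G \<and> (\<forall>u\<in>K. \<forall>v\<in>K. u \<noteq> v \<longrightarrow> (u, v) \<in> parcs G)"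

definition is_independent :: "'a pair_pre_digraph \<Rightarrow> 'a set \<Rightarrow> bool" where
  "is_independent G I \<longleftrightarrow> I \<subseteq> pverts G \<and> (\<forall>u\<in>I. \<forall>v\<in>I. (u, v) \<notin> parcs G)"

definition split_graph :: "'a pair_pre_digraph \<Rightarrow> bool" where
  "split_graph G \<longleftrightarrow> nonempty_graph G \<and>
     (\<exists>K I. pverts G = K \<union> I \<and> K \<inter> I = {} \<and> is_clique G K \<and> is_independent G I)"

text \<open>
  Real matrices whose rows and columns are indexed by a finite set \<open>V\<close> are represented as
  functions \<open>'a \<Rightarrow> 'a \<Rightarrow> real\<close>, of which only the entries at indices in \<open>V\<close> are relevant. This
  avoids an arbitrary enumeration of the vertices of a graph.
\<close>

definition mat_mult_on ::
    "'a set \<Rightarrow> ('a \<Rightarrow> 'a \<Rightarrow> real) \<Rightarrow> ('a \<Rightarrow> 'a \<Rightarrow> real) \<Rightarrow> 'a \<Rightarrow> 'a \<Rightarrow> real" where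
  "mat_mult_on V A B = (\<lambda>u v. \<Sum>w\<in>V. A u w * B w v)"

definition mat_id :: "'a \<Rightarrow> 'a \<Rightarrow> real" where
  "mat_id = (\<lambda>u v. if u = v then 1 else 0)"

definition trace_on :: "'a set \<Rightarrow> ('a \<Rightarrow> 'a \<Rightarrow> real) \<Rightarrow> real" where
  "trace_on V A = (\<Sum>v\<in>V. A v v)"

definition adjacency_matrix :: "'a pair_pre_digraph \<Rightarrow> 'a \<Rightarrow> 'a \<Rightarrow> real" where
  "adjacency_matrix G = (\<lambda>u v. if (u, v) \<in> parcs G then 1 else 0)"

text \<open>
  Binary words are lists of booleans: \<open>True\<close> is the letter 1, \<open>False\<close> the letter 0.
\<close>

definition letter_matrix :: "bool \<Rightarrow> 'a pair_pre_digraph \<Rightarrow> 'a \<Rightarrow> 'a \<Rightarrow> real" where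
  "letter_matrix b G = adjacency_matrix (if b then G else graph_complement G)"

primrec word_matrix :: "bool list \<Rightarrow> 'a pair_pre_digraph \<Rightarrow> 'a \<Rightarrow> 'a \<Rightarrow> real" where
  "word_matrix [] G = mat_id"
| "word_matrix (b # \<beta>) G = mat_mult_on (pverts G) (letter_matrix b G) (word_matrix \<beta> G)"

definition word_trace :: "bool list \<Rightarrow> 'a pair_pre_digraph \<Rightarrow> real" where
  "word_trace \<beta> G = trace_on (pverts G) (word_matrix \<beta> G)"

text \<open>
  Real-valued functions form a real vector space under the pointwise operations. Addition is the
  pointwise one of the library; there is no \<open>real_vector\<close> instance for functions, so the scalar
  multiplication is given explicitly.
\<close>

definition fun_scale :: "real \<Rightarrow> ('b \<Rightarrow> real) \<Rightarrow> 'b \<Rightarrow> real" where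
  "fun_scale r f = (\<lambda>x. r * f x)"

global_interpretation real_fun: vector_space fun_scale
  by unfold_locales (simp_all add: fun_scale_def fun_eq_iff algebra_simps)

text \<open>
  The elements of this space are functions on the whole record type; their values outside
  \<open>nonempty_graph\<close> carry no meaning.
\<close>

definition trace_space :: "('a pair_pre_digraph \<Rightarrow> real) set" where
  "trace_space = real_fun.span {word_trace \<beta> | \<beta>. \<beta> \<noteq> []}"

lemma trace_space_iff:
  fixes \<Phi> :: "'a pair_pre_digraph \<Rightarrow> real"
  shows "\<Phi> \<in> trace_space \<longleftrightarrow>
     (\<exists>W c. finite W \<and> [] \<notin> W \<and> (\<forall>G. \<Phi> G = (\<Sum>\<beta>\<in>W. c \<beta> * word_trace \<beta> G)))"
    (is "?L \<longleftrightarrow> ?R")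
proof
  have sum_app: "(\<Sum>x\<in>X. f x) G = (\<Sum>x\<in>X. f x G)"
    for X :: "'c set" and f :: "'c \<Rightarrow> 'd \<Rightarrow> real" and G
    by (induction X rule: infinite_finite_induct) simp_all
  {
    assume ?L
    then obtain t r where t: "finite t" "t \<subseteq> {word_trace \<beta> | \<beta>. \<beta> \<noteq> []}"
      and \<Phi>: "\<Phi> = (\<Sum>a\<in>t. fun_scale (r a) a)"
      unfolding trace_space_def real_fun.span_explicit by blast
    have "t \<subseteq> word_trace ` {\<beta>. \<beta> \<noteq> []}" using t(2) by auto
    then obtain W where W: "W \<subseteq> {\<beta>. \<beta> \<noteq> []}" "t = word_trace ` W"
      "inj_on (word_trace :: bool list \<Rightarrow> 'a pair_pre_digraph \<Rightarrow> real) W"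
      unfolding subset_image_inj by blast
    have "finite W" using t(1) W(3) unfolding W(2) by (rule finite_imageD)
    moreover have "\<Phi> G = (\<Sum>\<beta>\<in>W. r (word_trace \<beta>) * word_trace \<beta> G)" for G
      unfolding \<Phi> W(2) sum_app using W(3) by (simp add: sum.reindex fun_scale_def)
    ultimately show ?R using W(1) by (intro exI[of _ W] exI[of _ "\<lambda>\<beta>. r (word_trace \<beta>)"]) auto
  }
  {
    assume ?R
    then obtain W c where W: "finite W" "[] \<notin> W"
      and \<Phi>: "\<And>G. \<Phi> G = (\<Sum>\<beta>\<in>W. c \<beta> * word_trace \<beta> G)" by blast
    have "\<Phi> = (\<Sum>\<beta>\<in>W. fun_scale (c \<beta>) (word_trace \<beta>))"
      by (simp add: fun_eq_iff \<Phi> sum_app fun_scale_def)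
    moreover have "\<dots> \<in> trace_space"
      unfolding trace_space_def
      using W(2) by (intro real_fun.span_sum real_fun.span_scale real_fun.span_base) auto
    ultimately show ?L by simp
  }
qed

end

theory Submission
  imports
    Defs
    "HOL-Computational_Algebra.Formal_Power_Series"
    "HOL-Computational_Algebra.Polynomial"
    "HOL-Library.Countable"
begin

text \<open>
  Write \<open>A\<close> for the adjacency matrix of \<open>G\<close>, \<open>J\<close> for the all-ones matrix, and
  \<open>w\<^sub>k = 1\<^sup>T A\<^sup>k 1\<close> for the number of walks with \<open>k\<close> steps. The complement has the matrix
  \<open>J - I - A\<close>, and \<open>J\<close> has rank one. Expanding a word in \<open>A\<close> and \<open>J - I - A\<close> therefore gives a real
  polynomial in \<open>A\<close> plus terms \<open>A\<^sup>i J A\<^sup>j\<close> whose coefficients are products of walk counts, and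
  the trace of such a term is that product times \<open>w\<^bsub>i+j\<^esub>\<close>. As \<open>tr A\<^sup>0 = w\<^sub>0\<close>, \<open>tr A = 0\<close> and
  \<open>tr A\<^sup>2 = w\<^sub>1\<close>, every element of the trace space has on all graphs the form
  \<open>\<Sum>k=3..N. c\<^sub>k tr A\<^sup>k + P(w\<^sub>0, w\<^sub>1, \<dots>)\<close> with a polynomial \<open>P\<close> (\<open>trace_space_form\<close>). It
  remains to show that split graphs separate these expressions.

  The split graphs used consist of blocks, the \<open>t\<close>-th kind being the complete bipartite graph
  \<open>K\<^bsub>t,t\<^sup>2\<^esub>\<close>; all sides of size \<open>t\<close> together form the clique, all sides of size \<open>t\<^sup>2\<close> the
  independent set. The walk counts and the closed walk counts of such a graph are polynomials in
  the power sums \<open>\<rho>\<^sub>j\<close> of the block sizes. Indeed, three families of moments matter: the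
  clique vertices contribute \<open>t\<sqdot>(t\<^sup>3)\<^sup>i\<close>, the excursions from the clique to the independent set
  \<open>(t\<^sup>3)\<^sup>i\<close>, and the independent vertices \<open>t\<^sup>2\<sqdot>(t\<^sup>3)\<^sup>i\<close>; the exponents are distinct, so the three
  families are independent parameters. A polynomial identity between power sums of natural numbers
  holds for arbitrary real \<open>\<rho>\<close> (\<open>polyfun_zero_if_zero_on_power_sums\<close>). Hence the hypothesis passes
  from split graphs to virtual split graphs, given by an arbitrary real sequence \<open>\<rho>\<close>.

  Given any graph \<open>G\<close> and any real \<open>p\<close>, there is a virtual split graph with \<open>p\<close> clique vertices
  that has exactly the walk counts of \<open>G\<close> (\<open>prescribed_walk_series\<close>). Along this family
  \<open>P(w\<^sub>0, w\<^sub>1, \<dots>)\<close> is constant, so \<open>\<Sum>k=3..N. c\<^sub>k tr A\<^sup>k\<close> is constant too. But as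
  \<open>p\<close> grows, \<open>tr A\<^sup>k\<close> grows like a nonzero multiple of \<open>p\<^sup>k\<close> for each \<open>k \<ge> 3\<close>
  (\<open>trace_series_asymptotics\<close>, \<open>trace_lead_nonzero\<close>), so all \<open>c\<^sub>k\<close> vanish. Then
  \<open>P(w\<^sub>0, w\<^sub>1, \<dots>) = 0\<close> for the walk counts of \<open>G\<close>, and the given combination vanishes at \<open>G\<close>.
\<close>

unbundle fps_syntax

section \<open>Polynomial functions of real sequences\<close>

text \<open>
  Real polynomials in countably many variables, encoded by the functions that they define; each of
  them uses only finitely many entries of the sequence.
\<close>

inductive polyfun :: "((nat \<Rightarrow> real) \<Rightarrow> real) \<Rightarrow> bool" where
  polyfun_const: "polyfun (\<lambda>_. c)"
| polyfun_var: "polyfun (\<lambda>x. x j)"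
| polyfun_add: "polyfun p \<Longrightarrow> polyfun q \<Longrightarrow> polyfun (\<lambda>x. p x + q x)"
| polyfun_mult: "polyfun p \<Longrightarrow> polyfun q \<Longrightarrow> polyfun (\<lambda>x. p x * q x)"

lemmas polyfun_basic = polyfun_const polyfun_var polyfun_add polyfun_mult

lemma polyfun_sum: "(\<And>i. i \<in> I \<Longrightarrow> polyfun (p i)) \<Longrightarrow> polyfun (\<lambda>x. \<Sum>i\<in>I. p i x)"
  by (induction I rule: infinite_finite_induct) (auto intro: polyfun_basic)

lemma polyfun_diff: "polyfun p \<Longrightarrow> polyfun q \<Longrightarrow> polyfun (\<lambda>x. p x - q x)"
  using polyfun_add[OF _ polyfun_mult[OF polyfun_const[of "-1"]], of p q] by simp

lemma polyfun_compose:
  assumes "polyfun p" and "\<And>k. polyfun (\<lambda>x. f x k)"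
  shows "polyfun (\<lambda>x. p (f x))"
  using assms(1) by induction (auto intro: polyfun_basic assms(2))

lemma polyfun_finite_support:
  assumes "polyfun p"
  obtains D where "\<And>x y. (\<And>j. j \<le> D \<Longrightarrow> x j = y j) \<Longrightarrow> p x = p y"
proof -
  have "\<exists>D. \<forall>x y. (\<forall>j\<le>D. x j = y j) \<longrightarrow> p x = p y"
    using assms
  proof induction
    case (polyfun_add p q)
    then obtain D E where "\<forall>x y. (\<forall>j\<le>D. x j = y j) \<longrightarrow> p x = p y"
      "\<forall>x y. (\<forall>j\<le>E. x j = y j) \<longrightarrow> q x = q y" by blast
    then show ?case by (intro exI[of _ "max D E"]) (metis max.coboundedI1 max.coboundedI2)
  next
    case (polyfun_mult p q)
    then obtain D E where "\<forall>x y. (\<forall>j\<le>D. x j = y j) \<longrightarrow> p x = p y"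
      "\<forall>x y. (\<forall>j\<le>E. x j = y j) \<longrightarrow> q x = q y" by blast
    then show ?case by (intro exI[of _ "max D E"]) (metis max.coboundedI1 max.coboundedI2)
  qed auto
  then show thesis using that by blast
qed

lemma polyfun_in_one_variable:
  assumes "polyfun p"
  obtains q where "\<And>r. p (x(m := r)) = poly q r"
proof -
  have "\<exists>q. \<forall>r. p (x(m := r)) = poly q r"
    using assms
  proof induction
    case (polyfun_const c)
    then show ?case by (intro exI[of _ "[:c:]"]) simp
  next
    case (polyfun_var j)
    show ?case by (intro exI[of _ "if j = m then [:0, 1:] else [:x j:]"]) simp
  next
    case (polyfun_add p q)
    then show ?case by (metis poly_add)
  next
    case (polyfun_mult p q)
    then show ?case by (metis poly_mult)
  qed
  then show thesis using that by blast
qed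

lemma poly_zero_on_Nats:
  fixes q :: "real poly"
  assumes "\<And>n::nat. poly q (real n) = 0"
  shows "q = 0"
proof (rule ccontr)
  assume "q \<noteq> 0"
  then have "finite {r. poly q r = 0}" by (rule poly_roots_finite)
  moreover have "range real \<subseteq> {r. poly q r = 0}" using assms by auto
  moreover have "infinite (range real)" by (intro range_inj_infinite) (simp add: inj_def)
  ultimately show False using finite_subset by blast
qed

text \<open>
  The entries are freed one after the other: in a single entry the function is a univariate
  polynomial, which has infinitely many zeros at the naturals.
\<close>

lemma polyfun_zero_if_zero_on_Nats:
  assumes p: "polyfun p" and zero: "\<And>n :: nat \<Rightarrow> nat. p (\<lambda>j. real (n j)) = 0"
  shows "p x = 0"
proof -
  \<comment> \<open>Only the entries from \<open>m\<close> on are still restricted to natural numbers.\<close>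
  have partly: "p y = 0" if "\<And>j. j \<ge> m \<Longrightarrow> y j \<in> \<nat>" for m y
    using that
  proof (induction m arbitrary: y)
    case 0
    then have "\<forall>j. \<exists>n. y j = real n" by (auto elim: Nats_cases)
    then obtain n where "\<And>j. y j = real (n j)" by metis
    then have "y = (\<lambda>j. real (n j))" by blast
    then show ?case using zero by simp
  next
    case (Suc m)
    obtain q where q: "\<And>r. p (y(m := r)) = poly q r"
      using polyfun_in_one_variable[OF p] by blast
    have "poly q (real n) = 0" for n
      unfolding q[symmetric] by (rule Suc.IH) (use Suc.prems in auto)
    then have "q = 0" by (rule poly_zero_on_Nats)
    then show ?case using q[of "y m"] by simp
  qed
  obtain D where D: "\<And>x y. (\<And>j. j \<le> D \<Longrightarrow> x j = y j) \<Longrightarrow> p x = p y"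
    using polyfun_finite_support[OF p] by blast
  have "p x = p (\<lambda>j. if j \<le> D then x j else 0)" by (rule D) simp
  also have "\<dots> = 0" by (rule partly[of "Suc D"]) auto
  finally show ?thesis .
qed

definition lagrange :: "nat \<Rightarrow> nat \<Rightarrow> real poly" where
  "lagrange D t = (\<Prod>u\<in>{..D} - {t}. smult (1 / (real t - real u)) [:- real u, 1:])"

lemma poly_lagrange: "t \<le> D \<Longrightarrow> u \<le> D \<Longrightarrow> poly (lagrange D t) (real u) = (if u = t then 1 else 0)"
  by (auto simp: lagrange_def poly_prod simp flip: diff_divide_distrib intro!: prod.neutral)

lemma degree_lagrange: "t \<le> D \<Longrightarrow> degree (lagrange D t) \<le> D"
proof -
  assume "t \<le> D"
  have "degree (lagrange D t) \<le> (\<Sum>u\<in>{..D} - {t}. degree (smult (1 / (real t - real u)) [:- real u, 1:]))"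
    unfolding lagrange_def by (rule degree_prod_sum_le[THEN order_trans]) (auto simp: o_def)
  also have "\<dots> \<le> (\<Sum>u\<in>{..D} - {t}. 1)" by (intro sum_mono) auto
  also have "\<dots> = D" using \<open>t \<le> D\<close> by simp
  finally show ?thesis .
qed

text \<open>
  Invertibility of the Vandermonde matrix with nodes \<open>0, \<dots>, D\<close>: the weight of the node \<open>t\<close> is the
  value at the \<open>t\<close>-th Lagrange polynomial of the linear functional that maps \<open>x\<^sup>j\<close> to \<open>\<rho>\<^sub>j\<close>.
\<close>

lemma prescribed_moments:
  obtains r :: "nat \<Rightarrow> real" where "\<And>j. j \<le> D \<Longrightarrow> (\<Sum>t\<le>D. r t * real t ^ j) = \<rho> j"
proof -
  have interp: "(\<Sum>t\<le>D. smult (real t ^ j) (lagrange D t)) = monom 1 j" (is "?L = _") if "j \<le> D" for j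
  proof (rule poly_eqI_degree[where A = "real ` {..D}"])
    show "poly ?L x = poly (monom 1 j) x" if "x \<in> real ` {..D}" for x
      using that by (auto simp: poly_sum poly_lagrange poly_monom if_distrib cong: if_cong)
    have c: "card (real ` {..D}) = Suc D" by (subst card_image) (auto simp: inj_on_def)
    show "degree ?L < card (real ` {..D})"
      unfolding c less_Suc_eq_le
      by (intro degree_sum_le) (auto intro: order_trans[OF degree_smult_le] degree_lagrange)
    show "degree (monom (1::real) j) < card (real ` {..D})"
      unfolding c using that by (simp add: degree_monom_eq)
  qed
  have "(\<Sum>t\<le>D. (\<Sum>i\<le>D. coeff (lagrange D t) i * \<rho> i) * real t ^ j) = \<rho> j" if "j \<le> D" for j
  proof -
    have "(\<Sum>t\<le>D. (\<Sum>i\<le>D. coeff (lagrange D t) i * \<rho> i) * real t ^ j)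
        = (\<Sum>i\<le>D. (\<Sum>t\<le>D. real t ^ j * coeff (lagrange D t) i) * \<rho> i)"
      unfolding sum_distrib_right by (subst sum.swap) (simp only: mult_ac)
    also have "\<dots> = (\<Sum>i\<le>D. coeff (\<Sum>t\<le>D. smult (real t ^ j) (lagrange D t)) i * \<rho> i)"
      by (simp add: coeff_sum)
    also have "\<dots> = (\<Sum>i\<le>D. if i = j then \<rho> i else 0)"
      unfolding interp[OF that] by (intro sum.cong) auto
    also have "\<dots> = \<rho> j" using that by simp
    finally show ?thesis .
  qed
  then show thesis by (rule that)
qed

text \<open>
  The power sums of a finite multiset of naturals, in which \<open>t\<close> occurs \<open>n t\<close> times, are linear in the
  multiplicities. By the preceding lemmas the multiplicities may be replaced by real weights, and real
  weights attain every finite sequence of moments.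
\<close>

lemma polyfun_zero_if_zero_on_power_sums:
  assumes p: "polyfun p"
    and zero: "\<And>D n. p (\<lambda>j. \<Sum>t\<le>D. real (n t) * real t ^ j) = 0"
  shows "p \<rho> = 0"
proof -
  obtain D where D: "\<And>x y. (\<And>j. j \<le> D \<Longrightarrow> x j = y j) \<Longrightarrow> p x = p y"
    using polyfun_finite_support[OF p] by blast
  obtain r where r: "\<And>j. j \<le> D \<Longrightarrow> (\<Sum>t\<le>D. r t * real t ^ j) = \<rho> j"
    using prescribed_moments by blast
  have "polyfun (\<lambda>r. p (\<lambda>j. \<Sum>t\<le>D. r t * real t ^ j))"
    by (rule polyfun_compose[OF p]) (intro polyfun_sum polyfun_basic)
  then have "p (\<lambda>j. \<Sum>t\<le>D. r t * real t ^ j) = 0"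
    by (rule polyfun_zero_if_zero_on_Nats) (rule zero)
  moreover have "p (\<lambda>j. \<Sum>t\<le>D. r t * real t ^ j) = p \<rho>" by (rule D) (rule r)
  ultimately show ?thesis by simp
qed

definition polyfun_fps :: "((nat \<Rightarrow> real) \<Rightarrow> real fps) \<Rightarrow> bool" where
  "polyfun_fps f \<longleftrightarrow> (\<forall>k. polyfun (\<lambda>x. f x $ k))"

lemma polyfun_fps_const: "polyfun_fps (\<lambda>_. c)"
  by (auto simp: polyfun_fps_def intro: polyfun_basic)

lemma polyfun_fps_add: "polyfun_fps f \<Longrightarrow> polyfun_fps g \<Longrightarrow> polyfun_fps (\<lambda>x. f x + g x)"
  by (auto simp: polyfun_fps_def intro: polyfun_basic)

lemma polyfun_fps_diff: "polyfun_fps f \<Longrightarrow> polyfun_fps g \<Longrightarrow> polyfun_fps (\<lambda>x. f x - g x)"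
  by (auto simp: polyfun_fps_def intro: polyfun_diff)

lemma polyfun_fps_mult: "polyfun_fps f \<Longrightarrow> polyfun_fps g \<Longrightarrow> polyfun_fps (\<lambda>x. f x * g x)"
  by (auto simp: polyfun_fps_def fps_mult_nth intro!: polyfun_sum polyfun_basic)

lemma polyfun_fps_compose: "polyfun_fps f \<Longrightarrow> polyfun_fps (\<lambda>x. f x oo s)"
  by (auto simp: polyfun_fps_def fps_compose_nth intro!: polyfun_sum polyfun_basic)

lemma polyfun_fps_deriv: "polyfun_fps f \<Longrightarrow> polyfun_fps (\<lambda>x. fps_deriv (f x))"
  by (auto simp: polyfun_fps_def intro!: polyfun_basic simp del: of_nat_Suc of_nat_add)

text \<open>
  The recursion for the coefficients of an inverse divides only by the constant term, which is 1.
\<close>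

lemma polyfun_fps_inverse:
  assumes f: "polyfun_fps f" and f0: "\<And>x. f x $ 0 = 1"
  shows "polyfun_fps (\<lambda>x. inverse (f x))"
  unfolding polyfun_fps_def
proof
  fix k show "polyfun (\<lambda>x. inverse (f x) $ k)"
  proof (induction k rule: less_induct)
    case (less k)
    show ?case
    proof (cases k)
      case 0
      then show ?thesis using f0 by (auto intro: polyfun_basic)
    next
      case (Suc m)
      have "inverse (f x) $ k = 0 - (\<Sum>i=1..k. f x $ i * inverse (f x) $ (k - i))" for x
      proof -
        have "(f x * inverse (f x)) $ k = 0"
          using f0[of x] Suc by (subst inverse_mult_eq_1') simp_all
        then have "(\<Sum>i=0..k. f x $ i * inverse (f x) $ (k - i)) = 0"
          unfolding fps_mult_nth .
        then show ?thesis using f0[of x] by (simp add: sum.atLeast_Suc_atMost del: fps_inverse_nth_0)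
      qed
      moreover have "polyfun (\<lambda>x. 0 - (\<Sum>i=1..k. f x $ i * inverse (f x) $ (k - i)))"
        by (intro polyfun_diff polyfun_const polyfun_sum polyfun_mult less.IH)
          (use f in \<open>auto simp: polyfun_fps_def\<close>)
      ultimately show ?thesis by simp
    qed
  qed
qed

section \<open>Walk and closed walk series of virtual split graphs\<close>

text \<open>
  A walk may not stay at a clique vertex, although the all-ones matrix on the clique has diagonal
  entries 1; correcting this produces the factor \<open>1/(1 + z)\<close>, where \<open>z\<close> is the variable \<open>fps_X\<close>.
  The series \<open>s = z\<^sup>2/(1 + z)\<close> is both the sum \<open>z + z'\<close> and the negated product \<open>- z z'\<close> of \<open>z\<close> and its
  conjugate \<open>z' = - z/(1 + z)\<close>. It arises because the matrix of a block of size \<open>t\<close>, with \<open>- I\<close> on its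
  clique part, acts on vectors that are constant on each side with two eigenvalues that satisfy
  \<open>\<lambda>\<^sup>2 + \<lambda> = t\<^sup>3\<close>; they have the sum \<open>- 1\<close>, like \<open>1/z\<close> and \<open>1/z'\<close>.
\<close>

definition recip1X :: "real fps" where "recip1X = inverse (1 + fps_X)"
definition symX :: "real fps" where "symX = fps_X ^ 2 * recip1X"

lemma recip1X_mult: "recip1X * (1 + fps_X) = 1"
  unfolding recip1X_def by (rule inverse_mult_eq_1) simp

lemma symX_mult: "symX * (1 + fps_X) = fps_X ^ 2"
  unfolding symX_def by (simp add: mult.assoc recip1X_mult)

lemma symX_nth_0 [simp]: "symX $ 0 = 0"
  by (simp add: symX_def fps_X_power_mult_nth)

lemma geometric_fps: "Abs_fps (\<lambda>i. a ^ i) * (1 - fps_const a * fps_X) = (1 :: real fps)"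
proof (rule fps_ext)
  fix k show "(Abs_fps (\<lambda>i. a ^ i) * (1 - fps_const a * fps_X)) $ k = (1 :: real fps) $ k"
    by (cases k) (simp_all add: algebra_simps)
qed

lemma inverse_fps_unique: "f * g = 1 \<Longrightarrow> inverse g = (f :: real fps)"
  by (metis fps_inverse_unique mult.commute)

lemma recip1X_nth: "recip1X $ k = (-1) ^ k"
proof -
  have "recip1X = Abs_fps (\<lambda>i. (-1) ^ i)"
    unfolding recip1X_def using geometric_fps[of "-1"] by (intro inverse_fps_unique) (simp flip: fps_const_neg)
  then show ?thesis by (metis fps_nth_Abs_fps)
qed

text \<open>
  The following series are those of the virtual split graph with power sums \<open>\<rho>\<close>. If \<open>\<rho>\<close> consists of
  the power sums of actual block sizes \<open>t\<close>, then \<open>moment_series r \<rho>\<close> is the sum of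
  \<open>t\<^sup>r / (1 - t\<^sup>3 s)\<close>. The formulas for \<open>walk_series\<close> (which is \<open>1 + z W\<close> for the generating function
  \<open>W\<close> of the walk counts) and \<open>trace_series\<close> come from \<open>A = A\<^sub>0 + 1\<^sub>K 1\<^sub>K\<^sup>T\<close>, where \<open>1\<^sub>K\<close> indicates the
  clique and \<open>A\<^sub>0\<close> acts blockwise, by inverting this rank-one perturbation:
  \<open>clique_series\<close> is \<open>z 1\<^sub>K\<^sup>T (I - z A\<^sub>0)\<^sup>-\<^sup>1 1\<^sub>K\<close> and \<open>excursion_series\<close> is
  \<open>z 1\<^sub>I\<^sup>T (I - z A\<^sub>0)\<^sup>-\<^sup>1 1\<^sub>K\<close> with the indicator \<open>1\<^sub>I\<close> of the independent set.
\<close>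

definition moment_series :: "nat \<Rightarrow> (nat \<Rightarrow> real) \<Rightarrow> real fps" where
  "moment_series r \<rho> = Abs_fps (\<lambda>i. \<rho> (3 * i + r)) oo symX"

definition clique_series :: "(nat \<Rightarrow> real) \<Rightarrow> real fps" where
  "clique_series \<rho> = fps_X * recip1X * moment_series 1 \<rho>"

definition excursion_series :: "(nat \<Rightarrow> real) \<Rightarrow> real fps" where
  "excursion_series \<rho> = symX * moment_series 3 \<rho>"

definition walk_series :: "(nat \<Rightarrow> real) \<Rightarrow> real fps" where
  "walk_series \<rho> = (1 + excursion_series \<rho>) ^ 2 * inverse (1 - clique_series \<rho>) + fps_X * moment_series 2 \<rho>"

definition trace_series :: "(nat \<Rightarrow> real) \<Rightarrow> real fps" where
  "trace_series \<rho> = fps_const (\<rho> 1) * recip1X + fps_const (\<rho> 2) + (2 + fps_X) * recip1X * excursion_series \<rho>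
     + fps_X * fps_deriv (clique_series \<rho>) * inverse (1 - clique_series \<rho>)"

lemma clique_series_nth_0 [simp]: "clique_series \<rho> $ 0 = 0"
  by (simp add: clique_series_def)

lemma polyfun_moment_series: "polyfun_fps (moment_series r)"
  unfolding moment_series_def by (rule polyfun_fps_compose) (auto simp: polyfun_fps_def intro: polyfun_basic)

lemma polyfun_clique_series: "polyfun_fps clique_series"
  unfolding clique_series_def using polyfun_moment_series by (intro polyfun_fps_mult polyfun_fps_const)

lemma polyfun_excursion_series: "polyfun_fps excursion_series"
  unfolding excursion_series_def using polyfun_moment_series by (intro polyfun_fps_mult polyfun_fps_const)

lemma polyfun_walk_series: "polyfun_fps walk_series"
  unfolding walk_series_def power2_eq_square
  using polyfun_moment_series polyfun_excursion_series polyfun_clique_series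
  by (intro polyfun_fps_add polyfun_fps_mult polyfun_fps_inverse polyfun_fps_diff polyfun_fps_const) auto

lemma polyfun_trace_series: "polyfun_fps trace_series"
proof -
  have "polyfun_fps (\<lambda>\<rho>. fps_const (\<rho> j))" for j
    unfolding polyfun_fps_def fps_nth_fps_const
    by (intro allI, case_tac "k = 0") (auto intro: polyfun_basic)
  then show ?thesis
    unfolding trace_series_def
    using polyfun_moment_series polyfun_excursion_series polyfun_clique_series
    by (intro polyfun_fps_add polyfun_fps_mult polyfun_fps_inverse polyfun_fps_diff
          polyfun_fps_deriv polyfun_fps_const) auto
qed

lemma compose_symX_unfold:
  "Abs_fps x oo symX = fps_const (x 0) + symX * (Abs_fps (\<lambda>i. x (Suc i)) oo symX)"
proof -
  have "Abs_fps x = fps_const (x 0) + fps_X * Abs_fps (\<lambda>i. x (Suc i))"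
    by (intro fps_ext) (simp split: nat.split)
  then have "Abs_fps x oo symX = (fps_const (x 0) + fps_X * Abs_fps (\<lambda>i. x (Suc i))) oo symX" by simp
  also have "\<dots> = fps_const (x 0) + symX * (Abs_fps (\<lambda>i. x (Suc i)) oo symX)"
    by (simp add: fps_compose_add_distrib fps_compose_mult_distrib)
  finally show ?thesis .
qed

text \<open>
  Since \<open>z\<^sup>2 = s + s z\<close>, power series in \<open>z\<close> form a module over the power series in \<open>s\<close> that is
  generated by \<open>1\<close> and \<open>z\<close>.
\<close>

lemma symX_decomposition:
  obtains x y where "V = (x oo symX) + fps_X * (y oo symX)"
proof -
  \<comment> \<open>Division by \<open>s\<close> after removal of the terms of degree 0 and 1.\<close>
  define T where "T U = fps_shift 2 U * (1 + fps_X)" for U :: "real fps"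
  define U where "U i = (T ^^ i) V" for i
  define C where "C m i = Abs_fps (\<lambda>k. U (i + k) $ m) oo symX" for m i
  define A where "A i = C 0 i + fps_X * C 1 i" for i
  have U: "U i = fps_const (U i $ 0) + fps_X * fps_const (U i $ 1) + symX * U (Suc i)" for i
  proof -
    have "symX * U (Suc i) = fps_X ^ 2 * fps_shift 2 (U i)"
    proof -
      have "U (Suc i) = fps_shift 2 (U i) * (1 + fps_X)" by (simp add: U_def T_def)
      then have "symX * U (Suc i) = symX * (1 + fps_X) * fps_shift 2 (U i)" by (simp only: mult_ac)
      then show ?thesis unfolding symX_mult .
    qed
    moreover have "U i = fps_const (U i $ 0) + fps_X * fps_const (U i $ 1) + fps_X ^ 2 * fps_shift 2 (U i)"
    proof (rule fps_ext)
      fix n show "U i $ n = (fps_const (U i $ 0) + fps_X * fps_const (U i $ 1) + fps_X ^ 2 * fps_shift 2 (U i)) $ n"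
        by (cases n; cases "n - 1") (simp_all add: fps_X_power_mult_nth)
    qed
    ultimately show ?thesis by simp
  qed
  have C: "C m i = fps_const (U i $ m) + symX * C m (Suc i)" for m i
    unfolding C_def using compose_symX_unfold[of "\<lambda>k. U (i + k) $ m"]
    by (simp only: add_0_right add_Suc_right add_Suc)
  have A: "A i = fps_const (U i $ 0) + fps_X * fps_const (U i $ 1) + symX * A (Suc i)" for i
    unfolding A_def C[of _ i] by (simp only: algebra_simps)
  have step: "U i - A i = fps_X ^ 2 * (recip1X * (U (Suc i) - A (Suc i)))" for i
  proof -
    have "U i - A i = (fps_const (U i $ 0) + fps_X * fps_const (U i $ 1) + symX * U (Suc i))
        - (fps_const (U i $ 0) + fps_X * fps_const (U i $ 1) + symX * A (Suc i))"
      by (rule arg_cong2[where f = "(-)", OF U A])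
    also have "\<dots> = symX * (U (Suc i) - A (Suc i))"
      by (simp only: add_diff_cancel_left right_diff_distrib)
    finally show ?thesis unfolding symX_def mult.assoc .
  qed
  \<comment> \<open>The difference is divisible by arbitrarily high powers of \<open>z\<close>.\<close>
  have "(U i - A i) $ k = 0" for i k
  proof (induction k arbitrary: i rule: less_induct)
    case (less k)
    show ?case
      unfolding step[of i] fps_X_power_mult_nth fps_mult_nth[of recip1X]
      using less by (auto intro!: sum.neutral)
  qed
  then have "U 0 - A 0 = 0" by (intro fps_ext) (simp del: fps_sub_nth)
  then have "V = (Abs_fps (\<lambda>k. U k $ 0) oo symX) + fps_X * (Abs_fps (\<lambda>k. U k $ 1) oo symX)"
    by (simp add: A_def C_def U_def)
  then show thesis by (rule that)
qed

definition sqrt_linear :: "real \<Rightarrow> real fps" where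
  "sqrt_linear c = fps_binomial (1 / 2) oo (fps_const (- c) * fps_X)"

lemma sqrt_linear_nth: "sqrt_linear c $ j = (1 / 2 gchoose j) * (- c) ^ j"
  by (simp add: sqrt_linear_def)

lemma sqrt_linear_square: "sqrt_linear c ^ 2 = 1 - fps_const c * fps_X"
proof -
  have "sqrt_linear c ^ 2 = fps_binomial (1 / 2) ^ 2 oo (fps_const (- c) * fps_X)"
    unfolding sqrt_linear_def by (rule fps_compose_power) simp
  also have "fps_binomial (1 / 2 :: real) ^ 2 = 1 + fps_X"
    by (simp add: fps_binomial_power fps_binomial_1)
  also have "(1 + fps_X) oo (fps_const (- c) * fps_X) = 1 + fps_const (- c) * fps_X"
    unfolding fps_compose_add_distrib by (subst fps_X_fps_compose_startby0) simp_all
  also have "\<dots> = 1 - fps_const c * fps_X"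
    by (rule fps_ext) simp
  finally show ?thesis .
qed

text \<open>
  With \<open>z' = - z/(1 + z)\<close> this is \<open>(1 + P z) (1 + P z') = 1 + P (z + z') + P\<^sup>2 z z'\<close>, the norm of
  \<open>1 + P z\<close>.
\<close>

lemma conjugate_factors_ring:
  fixes P y e s :: "'a :: comm_ring_1"
  assumes e: "e * (1 + y) = 1" and s: "s = y ^ 2 * e"
  shows "(1 + P * y) * (1 - P * y * e) = 1 - (P * P - P) * s"
proof -
  have "y - y * e = y * (e * (1 + y)) - y * e" using e by simp
  also have "\<dots> = s" by (simp add: s power2_eq_square algebra_simps)
  finally have y: "y - y * e = s" .
  have "(1 + P * y) * (1 - P * y * e) = 1 + P * (y - y * e) - P * P * (y ^ 2 * e)"
    by (simp add: algebra_simps power2_eq_square)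
  also have "\<dots> = 1 + P * s - P * P * s" by (simp only: y flip: s)
  also have "\<dots> = 1 - (P * P - P) * s" by (simp add: algebra_simps)
  finally show ?thesis .
qed

lemmas conjugate_factors = conjugate_factors_ring[OF recip1X_mult symX_def]

section \<open>Virtual split graphs with a prescribed walk series\<close>

text \<open>
  Decompose \<open>V = X(s) + z Y(s)\<close>. If the clique has \<open>p\<close> vertices and the higher moments \<open>\<rho>\<^sub>4, \<rho>\<^sub>7, \<dots>\<close>
  vanish, then \<open>1/(1 - clique_series)\<close> equals \<open>(1 + p z) / (1 - p (p - 1) s)\<close> by the norm identity.
  Comparing the two components of \<open>walk_series \<rho> = V\<close> leaves the equations
  \<open>(1 + excursion_series)\<^sup>2 = X(s) (1 - p (p - 1) s)\<close> and \<open>moment_series 2 = Y(s) - p X(s)\<close>. They are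
  solved by a square root, and the three residue classes of the index of \<open>\<rho>\<close> can be chosen
  separately. The series \<open>R\<close> is the square root of \<open>X\<close>; it does not depend on \<open>p\<close>.
\<close>

lemma prescribed_walk_series:
  assumes "V $ 0 = 1"
  obtains R \<rho> where "R $ 0 = 1"
    and "\<And>p. \<rho> p 1 = p"
    and "\<And>p. walk_series (\<rho> p) = V"
    and "\<And>p. excursion_series (\<rho> p) = (R * sqrt_linear (p * (p - 1)) oo symX) - 1"
    and "\<And>p. clique_series (\<rho> p) = fps_const p * fps_X * recip1X"
proof -
  obtain x y where V: "V = (x oo symX) + fps_X * (y oo symX)"
    using symX_decomposition .
  have x0: "x $ 0 = 1" using assms V by simp
  define R where "R = fps_radical (\<lambda>_ _. 1) (Suc 1) x"
  have R2: "R ^ 2 = x" unfolding R_def numeral_2_eq_2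
    using x0 power_radical[of x "\<lambda>_ _. 1" 1] by simp
  have R0: "R $ 0 = 1" by (simp add: R_def)
  define \<rho> where "\<rho> p j = (if j mod 3 = 1 then if j = 1 then p else 0
    else if j mod 3 = 2 then (y - fps_const p * x) $ (j div 3)
    else (R * sqrt_linear (p * (p - 1))) $ (j div 3))" for p j
  have "Abs_fps (\<lambda>i. \<rho> p (3 * i + 1)) = fps_const p" for p
    by (rule fps_ext) (simp add: \<rho>_def)
  then have first: "moment_series 1 (\<rho> p) = fps_const p" for p
    unfolding moment_series_def by simp
  have "(3 * i + 2) mod 3 = 2" "(3 * i + 2) div 3 = i" for i :: nat
    by presburger+
  then have "Abs_fps (\<lambda>i. \<rho> p (3 * i + 2)) = y - fps_const p * x" for p
    by (intro fps_ext) (simp add: \<rho>_def del: add_2_eq_Suc')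
  then have second: "moment_series 2 (\<rho> p) = (y oo symX) - fps_const p * (x oo symX)" for p
    unfolding moment_series_def by (simp add: fps_compose_sub_distrib fps_compose_mult_distrib)
  have "R * sqrt_linear (p * (p - 1)) oo symX = 1 + symX * moment_series 3 (\<rho> p)" for p
  proof -
    have "Abs_fps (\<lambda>i. (R * sqrt_linear (p * (p - 1))) $ Suc i) = Abs_fps (\<lambda>i. \<rho> p (3 * i + 3))"
      by (rule fps_ext) (simp add: \<rho>_def)
    moreover have "(R * sqrt_linear (p * (p - 1))) $ 0 = 1"
      using R0 by (simp add: sqrt_linear_nth)
    ultimately show ?thesis
      using compose_symX_unfold[of "\<lambda>i. (R * sqrt_linear (p * (p - 1))) $ i"]
      by (simp add: moment_series_def fps_nth_inverse)
  qed
  then have th: "excursion_series (\<rho> p) = (R * sqrt_linear (p * (p - 1)) oo symX) - 1" for p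
    unfolding excursion_series_def by simp
  have al: "clique_series (\<rho> p) = fps_const p * fps_X * recip1X" for p
    unfolding clique_series_def first by (simp only: mult_ac)
  have "walk_series (\<rho> p) = V" for p
  proof -
    have "(R * sqrt_linear (p * (p - 1)) oo symX) ^ 2 = (R * sqrt_linear (p * (p - 1))) ^ 2 oo symX"
      by (rule fps_compose_power) simp
    also have "\<dots> = (x oo symX) * (1 - fps_const (p * (p - 1)) * symX)"
      by (simp only: power_mult_distrib R2 sqrt_linear_square)
        (simp add: fps_compose_sub_distrib fps_compose_mult_distrib del: fps_const_mult)
    also have "1 - fps_const (p * (p - 1)) * symX
        = (1 + fps_const p * fps_X) * (1 - fps_const p * fps_X * recip1X)"
    proof -
      have "fps_const (p * (p - 1)) = fps_const p * fps_const p - fps_const p"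
        by (simp add: algebra_simps)
      then show ?thesis using conjugate_factors[of "fps_const p"] by simp
    qed
    finally have sq: "(1 + excursion_series (\<rho> p)) ^ 2
        = (x oo symX) * ((1 + fps_const p * fps_X) * (1 - clique_series (\<rho> p)))"
      unfolding th al by simp
    have inv: "(1 - clique_series (\<rho> p)) * inverse (1 - clique_series (\<rho> p)) = 1"
      by (rule inverse_mult_eq_1') simp
    have "walk_series (\<rho> p) = (x oo symX) * (1 + fps_const p * fps_X)
        * ((1 - clique_series (\<rho> p)) * inverse (1 - clique_series (\<rho> p))) + fps_X * moment_series 2 (\<rho> p)"
      unfolding walk_series_def sq by (simp only: mult.assoc)
    also have "\<dots> = V"
      unfolding inv second V by (simp only: algebra_simps mult_1_right mult_1_left)
    finally show ?thesis .
  qed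
  moreover have "\<rho> p 1 = p" for p by (simp add: \<rho>_def)
  ultimately show thesis using R0 th al by (intro that[of R \<rho>])
qed

section \<open>Growth of the closed walk counts on a fibre of the walk series\<close>

text \<open>
  The right side is the generating function of the numbers \<open>(p - 1)\<^sup>k - (- 1)\<^sup>k\<close>. Adding \<open>p/(1 + z)\<close>
  gives the closed walk counts of the complete graph on \<open>p\<close> vertices.
\<close>

lemma trace_series_clique_part:
  "fps_X * fps_deriv (fps_const p * fps_X * recip1X) * inverse (1 - fps_const p * fps_X * recip1X)
     = Abs_fps (\<lambda>k. (p - 1) ^ k) - recip1X"
proof -
  define G :: "real fps" where "G = Abs_fps (\<lambda>k. (p - 1) ^ k)"
  define P where "P = fps_const p"
  have G: "G * (1 + fps_X - P * fps_X) = 1"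
  proof -
    have eq: "1 + fps_X - P * fps_X = 1 - fps_const (p - 1) * fps_X"
      unfolding P_def by (rule fps_ext) (simp add: algebra_simps)
    show ?thesis unfolding G_def eq by (rule geometric_fps)
  qed
  have "fps_deriv recip1X = - (recip1X ^ 2)"
    unfolding recip1X_def by (subst fps_inverse_deriv) simp_all
  then have "fps_deriv (fps_X * recip1X) = recip1X * (recip1X * (1 + fps_X)) - fps_X * recip1X ^ 2"
    unfolding recip1X_mult by simp
  also have "\<dots> = recip1X ^ 2" by (simp only: algebra_simps power2_eq_square) simp
  finally have d: "fps_deriv (P * (fps_X * recip1X)) = P * recip1X ^ 2"
    unfolding P_def fps_deriv_mult_const_left by simp
  have "G * (1 + fps_X) * (1 - P * (fps_X * recip1X)) = G * (1 + fps_X - P * fps_X * (recip1X * (1 + fps_X)))"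
    by (simp only: algebra_simps mult_1_left mult_1_right)
  also have "\<dots> = 1" unfolding recip1X_mult using G by simp
  finally have inv: "inverse (1 - P * (fps_X * recip1X)) = G * (1 + fps_X)"
    by (rule inverse_fps_unique)
  have "fps_X * (P * recip1X ^ 2) * (G * (1 + fps_X)) = fps_X * P * G * recip1X * (recip1X * (1 + fps_X))"
    by (simp only: mult_ac power2_eq_square)
  also have "\<dots> = P * fps_X * G * recip1X" unfolding recip1X_mult by (simp only: mult_ac mult_1_right mult_1_left)
  also have "\<dots> = G * (recip1X * (1 + fps_X)) - (G * (1 + fps_X - P * fps_X)) * recip1X"
    by (simp only: algebra_simps)
  also have "\<dots> = G - recip1X" unfolding recip1X_mult G by simp
  finally show ?thesis
    unfolding G_def[symmetric] P_def[symmetric] mult.assoc[of P] d inv .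
qed

lemma clique_coeff_asymptotics:
  assumes "2 * j \<le> m"
  shows "(\<lambda>n. (- (real n * (real n - 1))) ^ j / real n ^ m) \<longlonglongrightarrow> (if 2 * j = m then (-1) ^ j else 0)"
proof -
  have lim0: "(\<lambda>n. 1 / real n) \<longlonglongrightarrow> 0" by (rule lim_1_over_n)
  have "(\<lambda>n. (-1) ^ j * (1 - 1 / real n) ^ j * (1 / real n) ^ (m - 2 * j))
      \<longlonglongrightarrow> (-1) ^ j * (1 - 0) ^ j * 0 ^ (m - 2 * j)"
    by (intro tendsto_intros lim0)
  also have "(-1) ^ j * (1 - 0) ^ j * 0 ^ (m - 2 * j) = (if 2 * j = m then (-1) ^ j else (0 :: real))"
    using assms by (auto simp: power_0_left)
  finally show ?thesis
  proof (rule Lim_transform_eventually)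
    show "\<forall>\<^sub>F n in sequentially. (-1) ^ j * (1 - 1 / real n) ^ j * (1 / real n) ^ (m - 2 * j)
        = (- (real n * (real n - 1))) ^ j / real n ^ m"
      using eventually_gt_at_top[of 0]
    proof eventually_elim
      case (elim n)
      have "real n ^ m = real n ^ (2 * j) * real n ^ (m - 2 * j)"
        using assms by (simp flip: power_add)
      moreover have "(- (real n * (real n - 1))) ^ j = (-1) ^ j * (1 - 1 / real n) ^ j * real n ^ (2 * j)"
      proof -
        have "- (real n * (real n - 1)) = - 1 * (1 - 1 / real n) * real n ^ 2"
          using elim by (simp add: field_simps power2_eq_square)
        then show ?thesis by (simp only: power_mult_distrib power_mult)
      qed
      ultimately show ?case using elim by (simp add: power_divide)
    qed
  qed
qed

lemma div_power_tendsto_0: "k > 0 \<Longrightarrow> (\<lambda>n. c / real n ^ k) \<longlonglongrightarrow> 0"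
  using tendsto_mult[OF tendsto_const[of c] tendsto_power[OF lim_1_over_n, of k]]
  by (simp add: power_divide power_0_left)

text \<open>
  The leading coefficient in \<open>p\<close> of the \<open>k\<close>-th closed walk count: the clique contributes 1, and the
  excursions contribute twice the leading coefficient of the term of \<open>sqrt (1 - p (p - 1) s)\<close> at \<open>s\<^bsup>k/2\<^esup>\<close>.
\<close>

definition trace_lead :: "nat \<Rightarrow> real" where
  "trace_lead k = 1 + (if even k then 2 * (1 / 2 gchoose (k div 2)) * (-1) ^ (k div 2) else 0)"

text \<open>
  The quotient of consecutive coefficients has absolute value \<open>(j + 3/2) / (j + 3) < 1\<close>, and the
  coefficient at \<open>j = 0\<close> is \<open>- 1/8\<close>.
\<close>

lemma gchoose_half_small: "\<bar>1 / 2 gchoose (j + 2)\<bar> \<le> (1 / 8 :: real)"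
proof (induction j)
  case 0
  show ?case by (simp add: numeral_2_eq_2 gbinomial_Suc gbinomial_prod_rev prod.atLeast0_lessThan_Suc)
next
  case (Suc j)
  have "(1 / 2 gchoose Suc (j + 2)) = ((1 / 2 gchoose (j + 2)) * (1 / 2 - real (j + 2)) / (real (j + 3)) :: real)"
    using gbinomial_absorption'[of "Suc (j + 2)" "1/2 :: real"] gbinomial_mult_1[of "1/2 :: real" "j + 2"]
    by (simp add: field_simps)
  then have "\<bar>1 / 2 gchoose Suc (j + 2)\<bar> = \<bar>1 / 2 gchoose (j + 2)\<bar> * (\<bar>1 / 2 - real (j + 2)\<bar> / real (j + 3))"
    by (simp add: abs_mult)
  also have "\<dots> \<le> 1 / 8 * 1"
    using Suc by (intro mult_mono) (auto simp: field_simps)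
  finally show ?case by simp
qed

text \<open>
  For \<open>k = 2\<close> the value is \<open>1 - 1 = 0\<close>, in accordance with \<open>tr A\<^sup>2 = w\<^sub>1\<close>. From \<open>k = 4\<close> on the
  contribution of the excursions has absolute value at most \<open>1/4\<close>.
\<close>

lemma trace_lead_nonzero: "k \<ge> 3 \<Longrightarrow> trace_lead k \<noteq> 0"
proof (cases "even k")
  case True
  assume "k \<ge> 3"
  with True have "\<exists>j. k = 2 * (j + 2)" by presburger
  then obtain j where j: "k = 2 * (j + 2)" by blast
  have "\<bar>2 * (1 / 2 gchoose (j + 2)) * (-1) ^ (j + 2) :: real\<bar> \<le> 2 * (1 / 8)"
    unfolding abs_mult power_abs using gchoose_half_small[of j] by simp
  then show ?thesis unfolding trace_lead_def j by (simp del: power_Suc add_2_eq_Suc')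
next
  case False
  then show ?thesis by (simp add: trace_lead_def)
qed

lemma symX_power_coeff:
  shows "2 * i > k \<Longrightarrow> ((2 + fps_X) * recip1X * symX ^ i) $ k = 0"
    and "((2 + fps_X) * recip1X * symX ^ i) $ (2 * i) = 2"
proof -
  have "(2 + fps_X) * recip1X * symX ^ i = fps_X ^ (2 * i) * ((2 + fps_X) * recip1X * recip1X ^ i)"
    unfolding symX_def power_mult_distrib power_mult by (simp only: mult_ac)
  then have eq: "((2 + fps_X) * recip1X * symX ^ i) $ k = (if k < 2 * i then 0 else ((2 + fps_X) * recip1X * recip1X ^ i) $ (k - 2 * i))" for k
    by (simp only: fps_X_power_mult_nth)
  show "2 * i > k \<Longrightarrow> ((2 + fps_X) * recip1X * symX ^ i) $ k = 0" unfolding eq by simp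
  show "((2 + fps_X) * recip1X * symX ^ i) $ (2 * i) = 2"
    unfolding eq by (simp add: recip1X_nth fps_nth_power_0)
qed

text \<open>
  The \<open>i\<close>-th coefficient of \<open>1 + excursion_series\<close>, as a series in \<open>s\<close>, is a polynomial of degree
  \<open>2 i\<close> in \<open>p\<close>, and \<open>s\<^sup>i\<close> starts at \<open>z\<^bsup>2 i\<^esup>\<close>. Hence in the coefficient of \<open>z\<^sup>k\<close> only \<open>i = k/2\<close>
  reaches the order \<open>p\<^sup>k\<close>.
\<close>

lemma trace_series_asymptotics:
  assumes R0: "R $ 0 = 1"
    and th: "\<And>p. excursion_series (\<rho> p) = (R * sqrt_linear (p * (p - 1)) oo symX) - 1"
    and al: "\<And>p. clique_series (\<rho> p) = fps_const p * fps_X * recip1X"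
    and p: "\<And>p. \<rho> p 1 = p"
    and k: "k \<ge> 2"
  shows "(\<lambda>n. trace_series (\<rho> (real n)) $ k / real n ^ k) \<longlonglongrightarrow> trace_lead k"
proof -
  let ?h = "\<lambda>i. ((2 + fps_X) * recip1X * symX ^ i) $ k"
  define g where "g i p = (R * sqrt_linear (p * (p - 1))) $ i" for i p
  have coeff: "trace_series (\<rho> p) $ k = (p - 1) ^ k + (-1) ^ k * (p - 1) - ?h 0 + (\<Sum>i\<le>k. g i p * ?h i)" for p
  proof -
    have "((2 + fps_X) * recip1X * (R * sqrt_linear (p * (p - 1)) oo symX)) $ k = (\<Sum>i\<le>k. g i p * ?h i)"
    proof -
      have "((2 + fps_X) * recip1X * (f oo symX)) $ k = (\<Sum>i\<le>k. f $ i * ?h i)" for f :: "real fps"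
      proof -
        have "((2 + fps_X) * recip1X * (f oo symX)) $ k
            = (\<Sum>j\<le>k. \<Sum>i\<le>k - j. ((2 + fps_X) * recip1X) $ j * (f $ i * (symX ^ i) $ (k - j)))"
          by (simp add: fps_mult_nth[of "(2 + fps_X) * recip1X"] fps_compose_nth sum_distrib_left atLeast0AtMost)
        also have "\<dots> = (\<Sum>j\<le>k. \<Sum>i\<le>k. ((2 + fps_X) * recip1X) $ j * (f $ i * (symX ^ i) $ (k - j)))"
        proof -
          have "(\<Sum>i\<le>k - j. f $ i * (symX ^ i) $ (k - j)) = (\<Sum>i\<le>k. f $ i * (symX ^ i) $ (k - j))" for j
          proof (rule sum.mono_neutral_left)
            show "\<forall>i\<in>{..k} - {..k - j}. f $ i * (symX ^ i) $ (k - j) = 0"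
              using startsby_zero_power_prefix[OF symX_nth_0] by simp
          qed auto
          then show ?thesis by (simp only: flip: sum_distrib_left)
        qed
        also have "\<dots> = (\<Sum>i\<le>k. f $ i * (\<Sum>j\<le>k. ((2 + fps_X) * recip1X) $ j * (symX ^ i) $ (k - j)))"
          by (subst sum.swap) (simp add: sum_distrib_left mult_ac)
        finally show ?thesis
          by (simp only: fps_mult_nth[of "(2 + fps_X) * recip1X"] atLeast0AtMost)
      qed
      then show ?thesis by (simp add: g_def)
    qed
    moreover have "trace_series (\<rho> p) $ k
        = p * recip1X $ k + ((H * (f oo symX)) $ k - H $ k) + ((p - 1) ^ k - recip1X $ k)"
      if H: "H = (2 + fps_X) * recip1X" and f: "R * sqrt_linear (p * (p - 1)) = f" for H f
      using k unfolding trace_series_def th al p trace_series_clique_part f H[symmetric]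
      by (simp add: right_diff_distrib)
    ultimately show ?thesis
      by (simp only: power_0 mult_1_right) (simp add: recip1X_nth algebra_simps)
  qed
  have g: "(\<lambda>n. g i (real n) / real n ^ k) \<longlonglongrightarrow> (if 2 * i = k then (1 / 2 gchoose i) * (-1) ^ i else 0)"
    if "2 * i \<le> k" for i
  proof -
    have "(\<lambda>n. \<Sum>j\<le>i. R $ j * ((1 / 2 gchoose (i - j)) * ((- (real n * (real n - 1))) ^ (i - j) / real n ^ k)))
      \<longlonglongrightarrow> (\<Sum>j\<le>i. R $ j * ((1 / 2 gchoose (i - j)) * (if 2 * (i - j) = k then (-1) ^ (i - j) else 0)))"
      using that by (intro tendsto_intros clique_coeff_asymptotics) auto
    also have "(\<lambda>n. \<Sum>j\<le>i. R $ j * ((1 / 2 gchoose (i - j)) * ((- (real n * (real n - 1))) ^ (i - j) / real n ^ k)))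
      = (\<lambda>n. g i (real n) / real n ^ k)"
      by (simp add: g_def fps_mult_nth sqrt_linear_nth sum_divide_distrib atLeast0AtMost)
    also have "(\<Sum>j\<le>i. R $ j * ((1 / 2 gchoose (i - j)) * (if 2 * (i - j) = k then (-1) ^ (i - j) else 0)))
      = (\<Sum>j\<in>{0}. R $ j * ((1 / 2 gchoose (i - j)) * (if 2 * (i - j) = k then (-1) ^ (i - j) else 0)))"
      using that k by (intro sum.mono_neutral_right) auto
    finally show ?thesis using R0 by (cases "2 * i = k") simp_all
  qed
  have "(\<lambda>n. g i (real n) / real n ^ k * ?h i) \<longlonglongrightarrow> (if 2 * i = k then 2 * (1 / 2 gchoose i) * (-1) ^ i else 0)"
    for i
  proof (cases "2 * i \<le> k")
    case True
    show ?thesis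
      using tendsto_mult_right[OF g[OF True], of "?h i"] symX_power_coeff(2)[of i]
      by (cases "2 * i = k") (auto simp: mult_ac)
  next
    case False
    then have "?h i = 0" by (intro symX_power_coeff(1)) simp
    then show ?thesis using False by simp
  qed
  then have "(\<lambda>n. \<Sum>i\<le>k. g i (real n) / real n ^ k * ?h i)
      \<longlonglongrightarrow> (\<Sum>i\<le>k. if 2 * i = k then 2 * (1 / 2 gchoose i) * (-1) ^ i else 0)"
    by (intro tendsto_sum)
  also have "(\<Sum>i\<le>k. if 2 * i = k then 2 * (1 / 2 gchoose i) * (-1) ^ i else (0::real)) = trace_lead k - 1"
  proof (cases "even k")
    case True
    then obtain j where j: "k = 2 * j" by blast
    have "(\<Sum>i\<le>k. if 2 * i = k then 2 * (1 / 2 gchoose i) * (-1) ^ i else (0::real))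
      = (\<Sum>i\<le>k. if i = j then 2 * (1 / 2 gchoose j) * (-1) ^ j else 0)"
      by (intro sum.cong) (auto simp: j)
    then show ?thesis by (simp add: j trace_lead_def)
  next
    case False
    then show ?thesis by (auto simp: trace_lead_def intro!: sum.neutral)
  qed
  finally have S: "(\<lambda>n. \<Sum>i\<le>k. g i (real n) / real n ^ k * ?h i) \<longlonglongrightarrow> trace_lead k - 1" .
  have c0: "(\<lambda>n. c / real n ^ k) \<longlonglongrightarrow> 0" for c
    using k by (intro div_power_tendsto_0) simp
  have "(\<lambda>n. 1 / real n ^ (k - 1) - 1 / real n ^ k) \<longlonglongrightarrow> 0 - 0"
    using k by (intro tendsto_diff div_power_tendsto_0) simp_all
  then have lin: "(\<lambda>n. (-1) ^ k * (1 / real n ^ (k - 1) - 1 / real n ^ k)) \<longlonglongrightarrow> 0"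
    by (auto intro!: tendsto_mult_right_zero)
  have "(\<lambda>n. (1 - 1 / real n) ^ k) \<longlonglongrightarrow> (1 - 0) ^ k"
    by (intro tendsto_intros lim_1_over_n)
  then have "(\<lambda>n. (1 - 1 / real n) ^ k + (-1) ^ k * (1 / real n ^ (k - 1) - 1 / real n ^ k) - ?h 0 / real n ^ k
      + (\<Sum>i\<le>k. g i (real n) / real n ^ k * ?h i)) \<longlonglongrightarrow> (1 - 0) ^ k + 0 - 0 + (trace_lead k - 1)"
    by (intro tendsto_add tendsto_diff lin S c0)
  then have "(\<lambda>n. (1 - 1 / real n) ^ k + (-1) ^ k * (1 / real n ^ (k - 1) - 1 / real n ^ k) - ?h 0 / real n ^ k
      + (\<Sum>i\<le>k. g i (real n) / real n ^ k * ?h i)) \<longlonglongrightarrow> trace_lead k" by simp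
  then show ?thesis
  proof (rule Lim_transform_eventually)
    show "\<forall>\<^sub>F n in sequentially. (1 - 1 / real n) ^ k + (-1) ^ k * (1 / real n ^ (k - 1) - 1 / real n ^ k) - ?h 0 / real n ^ k
      + (\<Sum>i\<le>k. g i (real n) / real n ^ k * ?h i) = trace_series (\<rho> (real n)) $ k / real n ^ k"
      using eventually_gt_at_top[of 0]
    proof eventually_elim
      case (elim n)
      have "(1 - 1 / real n) ^ k = (real n - 1) ^ k / real n ^ k"
        using elim by (simp add: diff_divide_eq_iff flip: power_divide)
      moreover have "(-1) ^ k * (1 / real n ^ (k - 1) - 1 / real n ^ k) = (-1) ^ k * (real n - 1) / real n ^ k"
        using elim k by (cases k) (simp_all add: field_simps)
      ultimately show ?case
        unfolding coeff by (simp only: add_divide_distrib diff_divide_distrib sum_divide_distrib times_divide_eq_left)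
    qed
  qed
qed

text \<open>
  Division by the highest power \<open>n\<^sup>N\<close> isolates the last coefficient in the limit; after its removal the
  same applies to the shorter sum.
\<close>

lemma leading_terms_independent:
  fixes T :: "nat \<Rightarrow> nat \<Rightarrow> real"
  assumes lim: "\<And>k. 3 \<le> k \<Longrightarrow> (\<lambda>n. T k n / real n ^ k) \<longlonglongrightarrow> l k"
    and nz: "\<And>k. 3 \<le> k \<Longrightarrow> l k \<noteq> 0"
    and const: "\<And>n. (\<Sum>k=3..N. c k * T k n) = C"
    and k: "k \<in> {3..N}"
  shows "c k = 0"
  using const k
proof (induction N arbitrary: k)
  case 0
  then show ?case by simp
next
  case (Suc N)
  show ?case
  proof (cases "3 \<le> Suc N")
    case False
    then show ?thesis using Suc.prems by simp
  next
    case True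
    have split: "(\<Sum>k=3..Suc N. f k) = (\<Sum>k=3..N. f k) + f (Suc N)" for f :: "nat \<Rightarrow> real"
      using True by simp
    have low: "(\<lambda>n. T k n / real n ^ Suc N) \<longlonglongrightarrow> 0" if "k \<in> {3..N}" for k
    proof -
      have "(\<lambda>n. T k n / real n ^ k * (1 / real n ^ (Suc N - k))) \<longlonglongrightarrow> l k * 0"
        using that by (intro tendsto_mult lim div_power_tendsto_0) auto
      moreover have "real n ^ k * real n ^ (Suc N - k) = real n ^ Suc N" for n
        using that by (simp flip: power_add)
      ultimately show ?thesis by simp
    qed
    have "(\<lambda>n. (\<Sum>k=3..N. c k * (T k n / real n ^ Suc N)) + c (Suc N) * (T (Suc N) n / real n ^ Suc N))
        \<longlonglongrightarrow> (\<Sum>k=3..N. c k * 0) + c (Suc N) * l (Suc N)"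
      using True by (intro tendsto_add tendsto_sum tendsto_mult_left low lim)
    also have "(\<lambda>n. (\<Sum>k=3..N. c k * (T k n / real n ^ Suc N)) + c (Suc N) * (T (Suc N) n / real n ^ Suc N))
        = (\<lambda>n. C / real n ^ Suc N)"
    proof
      fix n
      show "(\<Sum>k=3..N. c k * (T k n / real n ^ Suc N)) + c (Suc N) * (T (Suc N) n / real n ^ Suc N)
          = C / real n ^ Suc N"
        unfolding Suc.prems(1)[of n, symmetric] split add_divide_distrib sum_divide_distrib
          times_divide_eq_right ..
    qed
    finally have "(\<lambda>n. C / real n ^ Suc N) \<longlonglongrightarrow> c (Suc N) * l (Suc N)" by simp
    then have "c (Suc N) * l (Suc N) = 0"
      using div_power_tendsto_0[of "Suc N" C] LIMSEQ_unique by blast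
    then have top: "c (Suc N) = 0" using nz[OF True] by simp
    have "(\<Sum>k=3..N. c k * T k n) = C" for n
      using Suc.prems(1)[of n] unfolding split by (simp add: top)
    then show ?thesis
      using Suc.IH[of k] Suc.prems(2) top by (cases "k = Suc N") auto
  qed
qed

section \<open>Words in the adjacency matrices of a graph and its complement\<close>

abbreviation adj_power :: "'a pair_pre_digraph \<Rightarrow> nat \<Rightarrow> 'a \<Rightarrow> 'a \<Rightarrow> real" where
  "adj_power G k \<equiv> word_matrix (replicate k True) G"

text \<open>
  The vectors \<open>A\<^sup>k 1\<close> and \<open>1\<^sup>T A\<^sup>k\<close>. The rank-one matrix \<open>A\<^sup>i J A\<^sup>j\<close> is the product of the \<open>i\<close>-th row
  sums with the \<open>j\<close>-th column sums.
\<close>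

definition row_sum :: "'a pair_pre_digraph \<Rightarrow> nat \<Rightarrow> 'a \<Rightarrow> real" where
  "row_sum G k u = (\<Sum>v\<in>pverts G. adj_power G k u v)"

definition col_sum :: "'a pair_pre_digraph \<Rightarrow> nat \<Rightarrow> 'a \<Rightarrow> real" where
  "col_sum G k v = (\<Sum>u\<in>pverts G. adj_power G k u v)"

definition walks :: "'a pair_pre_digraph \<Rightarrow> nat \<Rightarrow> real" where
  "walks G k = (\<Sum>u\<in>pverts G. row_sum G k u)"

definition closed_walks :: "'a pair_pre_digraph \<Rightarrow> nat \<Rightarrow> real" where
  "closed_walks G k = word_trace (replicate k True) G"

lemma adj_power_Suc:
  "adj_power G (Suc k) u v = (\<Sum>w\<in>pverts G. adjacency_matrix G u w * adj_power G k w v)"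
  by (simp add: mat_mult_on_def letter_matrix_def)

lemma adj_mult_row_sum:
  "(\<Sum>w\<in>pverts G. adjacency_matrix G u w * row_sum G i w) = row_sum G (Suc i) u"
  unfolding row_sum_def adj_power_Suc sum_distrib_left by (rule sum.swap)

lemma row_sum_0: "finite (pverts G) \<Longrightarrow> u \<in> pverts G \<Longrightarrow> row_sum G 0 u = 1"
  by (simp add: row_sum_def mat_id_def)

lemma adj_power_add:
  assumes "finite (pverts G)" and "u \<in> pverts G"
  shows "adj_power G (j + i) u v = (\<Sum>w\<in>pverts G. adj_power G j u w * adj_power G i w v)"
  using assms(2)
proof (induction j arbitrary: u)
  case 0
  have "(\<Sum>w\<in>pverts G. adj_power G 0 u w * adj_power G i w v)
      = (\<Sum>w\<in>pverts G. if u = w then adj_power G i w v else 0)"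
    by (intro sum.cong) (auto simp: mat_id_def)
  then show ?case using assms(1) 0 by simp
next
  case (Suc j)
  have "adj_power G (Suc j + i) u v
      = (\<Sum>x\<in>pverts G. adjacency_matrix G u x * (\<Sum>w\<in>pverts G. adj_power G j x w * adj_power G i w v))"
    unfolding add_Suc adj_power_Suc by (intro sum.cong refl) (simp add: Suc.IH)
  also have "\<dots> = (\<Sum>w\<in>pverts G. (\<Sum>x\<in>pverts G. adjacency_matrix G u x * adj_power G j x w) * adj_power G i w v)"
    unfolding sum_distrib_left sum_distrib_right by (subst sum.swap) (simp only: mult.assoc)
  finally show ?case unfolding adj_power_Suc .
qed

lemma col_row_sum:
  assumes "finite (pverts G)"
  shows "(\<Sum>v\<in>pverts G. row_sum G i v * col_sum G j v) = walks G (j + i)"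
proof -
  have "walks G (j + i) = (\<Sum>u\<in>pverts G. \<Sum>x\<in>pverts G. \<Sum>v\<in>pverts G. adj_power G j u v * adj_power G i v x)"
    unfolding walks_def row_sum_def using adj_power_add[OF assms] by (intro sum.cong refl)
  also have "\<dots> = (\<Sum>u\<in>pverts G. \<Sum>v\<in>pverts G. adj_power G j u v * row_sum G i v)"
    unfolding row_sum_def sum_distrib_left by (rule sum.cong[OF refl], rule sum.swap)
  also have "\<dots> = (\<Sum>v\<in>pverts G. row_sum G i v * col_sum G j v)"
    unfolding col_sum_def sum_distrib_left by (subst sum.swap) (simp only: mult.commute)
  finally show ?thesis ..
qed

text \<open>
  The part of a word that contains at least one factor \<open>J\<close>: sums of matrices \<open>A\<^sup>i J A\<^sup>j\<close>, with
  coefficients that are polynomials in the walk counts, uniformly in the graph.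
\<close>

inductive rank_form :: "('a pair_pre_digraph \<Rightarrow> 'a \<Rightarrow> 'a \<Rightarrow> real) \<Rightarrow> bool" where
  rank_term: "polyfun P \<Longrightarrow> rank_form (\<lambda>G u v. P (walks G) * row_sum G i u * col_sum G j v)"
| rank_add: "rank_form Q \<Longrightarrow> rank_form R \<Longrightarrow> rank_form (\<lambda>G u v. Q G u v + R G u v)"

lemma rank_form_zero: "rank_form (\<lambda>G u v. 0)"
  using rank_term[OF polyfun_const[of 0]] by simp

lemma rank_form_sum: "(\<And>k. k \<in> I \<Longrightarrow> rank_form (Q k)) \<Longrightarrow> rank_form (\<lambda>G u v. \<Sum>k\<in>I. Q k G u v)"
  by (induction I rule: infinite_finite_induct) (auto intro: rank_form_zero rank_add)

lemma rank_form_scale: "rank_form Q \<Longrightarrow> rank_form (\<lambda>G u v. a * Q G u v)"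
proof (induction rule: rank_form.induct)
  case (rank_term P i j)
  show ?case using rank_form.rank_term[OF polyfun_mult[OF polyfun_const rank_term], of a i j]
    by (simp add: mult.assoc)
next
  case (rank_add Q R)
  then show ?case by (simp add: distrib_left rank_form.rank_add)
qed

lemma rank_form_adj:
  "rank_form Q \<Longrightarrow> rank_form (\<lambda>G. mat_mult_on (pverts G) (adjacency_matrix G) (Q G))"
proof (induction rule: rank_form.induct)
  case (rank_term P i j)
  have "mat_mult_on (pverts G) (adjacency_matrix G) (\<lambda>u v. P (walks G) * row_sum G i u * col_sum G j v)
     = (\<lambda>u v. P (walks G) * row_sum G (Suc i) u * col_sum G j v)" for G :: "'a pair_pre_digraph"
    unfolding mat_mult_on_def adj_mult_row_sum[symmetric] sum_distrib_left sum_distrib_right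
    by (simp only: mult_ac)
  then show ?case using rank_form.rank_term[OF rank_term] by simp
next
  case (rank_add Q R)
  then show ?case by (simp add: mat_mult_on_def distrib_left sum.distrib rank_form.rank_add)
qed

text \<open>
  Multiplication by \<open>J\<close> from the left: \<open>J A\<^sup>i J A\<^sup>j = w\<^sub>i J A\<^sup>j\<close>.
\<close>

lemma rank_form_col_sums:
  assumes "rank_form Q"
  obtains R where "rank_form R"
    and "\<And>G u v. finite (pverts G) \<Longrightarrow> u \<in> pverts G \<Longrightarrow> (\<Sum>w\<in>pverts G. Q G w v) = R G u v"
proof -
  have "\<exists>R. rank_form R \<and> (\<forall>G u v. finite (pverts G) \<longrightarrow> u \<in> pverts G \<longrightarrow> (\<Sum>w\<in>pverts G. Q G w v) = R G u v)"
    using assms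
  proof (induction rule: rank_form.induct)
    case (rank_term P i j)
    have "(\<Sum>w\<in>pverts G. P (walks G) * row_sum G i w * col_sum G j v) = (P (walks G) * walks G i) * row_sum G 0 u * col_sum G j v"
      if "finite (pverts G)" "u \<in> pverts G" for G :: "'a pair_pre_digraph" and u v
      using row_sum_0[OF that] by (simp add: walks_def flip: sum_distrib_left sum_distrib_right)
    then show ?case
      using rank_form.rank_term[OF polyfun_mult[OF rank_term polyfun_var[of i]], of 0 j] by blast
  next
    case (rank_add Q R)
    then obtain Q' R' where "rank_form Q'" "rank_form R'"
      and "\<And>G u v. finite (pverts G) \<Longrightarrow> u \<in> pverts G \<Longrightarrow> (\<Sum>w\<in>pverts G. Q G w v) = Q' G u v"
      and "\<And>G u v. finite (pverts G) \<Longrightarrow> u \<in> pverts G \<Longrightarrow> (\<Sum>w\<in>pverts G. R G w v) = R' G u v"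
      by blast
    then show ?case
      by (intro exI[of _ "\<lambda>G u v. Q' G u v + R' G u v"]) (auto intro: rank_form.rank_add simp: sum.distrib)
  qed
  then show thesis using that by blast
qed

lemma rank_form_trace:
  assumes "rank_form Q"
  obtains P where "polyfun P"
    and "\<And>G. finite (pverts G) \<Longrightarrow> trace_on (pverts G) (Q G) = P (walks G)"
proof -
  have "\<exists>P. polyfun P \<and> (\<forall>G. finite (pverts G) \<longrightarrow> trace_on (pverts G) (Q G) = P (walks G))"
    using assms
  proof (induction rule: rank_form.induct)
    case (rank_term P i j)
    have "trace_on (pverts G) (\<lambda>u v. P (walks G) * row_sum G i u * col_sum G j v) = P (walks G) * walks G (j + i)"
      if "finite (pverts G)" for G :: "'a pair_pre_digraph"
      unfolding trace_on_def col_row_sum[OF that, symmetric] sum_distrib_left by (simp only: mult.assoc)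
    then show ?case
      using polyfun_mult[OF rank_term polyfun_var[of "j + i"]] by blast
  next
    case (rank_add Q R)
    then obtain P P' where "polyfun P" "polyfun P'"
      "\<forall>G. finite (pverts G) \<longrightarrow> trace_on (pverts G) (Q G) = P (walks G)"
      "\<forall>G. finite (pverts G) \<longrightarrow> trace_on (pverts G) (R G) = P' (walks G)" by blast
    then show ?case
      by (intro exI[of _ "\<lambda>x. P x + P' x"]) (simp add: polyfun_add trace_on_def sum.distrib)
  qed
  then show thesis using that by blast
qed

lemma complement_letter:
  assumes "pair_graph G" and "u \<in> pverts G" and "w \<in> pverts G"
  shows "letter_matrix False G u w = 1 - (if u = w then 1 else 0) - adjacency_matrix G u w"
proof -
  interpret pair_graph G by fact
  show ?thesis
    using assms(2,3) by (auto simp: letter_matrix_def adjacency_matrix_def graph_complement_def dest: no_loops')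
qed

text \<open>
  Induction on the word: the letter 1 shifts the coefficients of the powers of \<open>A\<close>, and the letter 0
  multiplies by \<open>J - I - A\<close>, which turns \<open>A\<^sup>k\<close> into \<open>J A\<^sup>k - A\<^sup>k - A\<^bsup>k+1\<^esup>\<close>.
\<close>

lemma word_matrix_form:
  "\<exists>c Q. rank_form Q \<and> (\<forall>G u v. pair_graph G \<longrightarrow> u \<in> pverts G \<longrightarrow>
     word_matrix \<beta> G u v = (\<Sum>k\<le>length \<beta>. c k * adj_power G k u v) + Q G u v)"
proof (induction \<beta>)
  case Nil
  show ?case
    by (intro exI[of _ "\<lambda>_. 1"] exI[of _ "\<lambda>G u v. 0"]) (simp add: rank_form_zero)
next
  case (Cons b \<beta>)
  then obtain c and Q :: "'a pair_pre_digraph \<Rightarrow> 'a \<Rightarrow> 'a \<Rightarrow> real" where Q: "rank_form Q"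
    and IH: "\<And>G u v. pair_graph G \<Longrightarrow> u \<in> pverts G \<Longrightarrow>
     word_matrix \<beta> G u v = (\<Sum>k\<le>length \<beta>. c k * adj_power G k u v) + Q G u v" by blast
  define c' where "c' k = (case k of 0 \<Rightarrow> 0 | Suc m \<Rightarrow> c m)" for k
  define AQ where "AQ G = mat_mult_on (pverts G) (adjacency_matrix G) (Q G)" for G
  have AQ: "rank_form AQ" unfolding AQ_def by (rule rank_form_adj[OF Q])
  have adj: "(\<Sum>w\<in>pverts G. adjacency_matrix G u w * word_matrix \<beta> G w v)
      = (\<Sum>k\<le>Suc (length \<beta>). c' k * adj_power G k u v) + AQ G u v" if G: "pair_graph G" for G u v
  proof -
    have "(\<Sum>w\<in>pverts G. adjacency_matrix G u w * word_matrix \<beta> G w v)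
      = (\<Sum>w\<in>pverts G. \<Sum>k\<le>length \<beta>. c k * (adjacency_matrix G u w * adj_power G k w v))
        + (\<Sum>w\<in>pverts G. adjacency_matrix G u w * Q G w v)"
      unfolding sum.distrib[symmetric]
      by (intro sum.cong refl) (simp only: IH[OF G] distrib_left sum_distrib_left mult_ac)
    also have "(\<Sum>w\<in>pverts G. \<Sum>k\<le>length \<beta>. c k * (adjacency_matrix G u w * adj_power G k w v))
      = (\<Sum>k\<le>length \<beta>. c k * adj_power G (Suc k) u v)"
      unfolding adj_power_Suc sum_distrib_left by (rule sum.swap)
    also have "\<dots> = (\<Sum>k\<le>Suc (length \<beta>). c' k * adj_power G k u v)"
      unfolding sum.atMost_Suc_shift by (simp add: c'_def)
    finally show ?thesis by (simp add: AQ_def mat_mult_on_def)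
  qed
  show ?case
  proof (cases b)
    case True
    then have "word_matrix (b # \<beta>) G u v = (\<Sum>k\<le>length (b # \<beta>). c' k * adj_power G k u v) + AQ G u v"
      if "pair_graph G" for G u v
      using adj[OF that, of u v] by (simp add: mat_mult_on_def letter_matrix_def)
    then show ?thesis using AQ by blast
  next
    case False
    obtain R where R: "rank_form R"
      and R_eq: "\<And>G u v. finite (pverts G) \<Longrightarrow> u \<in> pverts G \<Longrightarrow> (\<Sum>w\<in>pverts G. Q G w v) = R G u v"
      using rank_form_col_sums[OF Q] by blast
    define S where "S G u v = (\<Sum>k\<le>length \<beta>. c k * (row_sum G 0 u * col_sum G k v)) + R G u v
        + (-1) * Q G u v + (-1) * AQ G u v" for G u v
    have t: "rank_form (\<lambda>G u v. c k * (row_sum G 0 u * col_sum G k v))" for k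
      using rank_term[OF polyfun_const[of "c k"], of 0 k] by (simp add: mult.assoc)
    have S: "rank_form S"
      unfolding S_def
      by (intro rank_add rank_form_sum[OF t] R rank_form_scale[OF Q] rank_form_scale[OF AQ])
    define c'' where "c'' k = - (if k \<le> length \<beta> then c k else 0) - c' k" for k
    have "word_matrix (b # \<beta>) G u v = (\<Sum>k\<le>length (b # \<beta>). c'' k * adj_power G k u v) + S G u v"
      if G: "pair_graph G" and u: "u \<in> pverts G" for G u v
    proof -
      interpret pair_graph G by fact
      have fin: "finite (pverts G)" by (rule pair_finite_verts)
      have "word_matrix (b # \<beta>) G u v = (\<Sum>w\<in>pverts G. letter_matrix False G u w * word_matrix \<beta> G w v)"
        using False by (simp add: mat_mult_on_def)
      also have "\<dots> = (\<Sum>w\<in>pverts G. word_matrix \<beta> G w v - (if u = w then word_matrix \<beta> G w v else 0)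
          - adjacency_matrix G u w * word_matrix \<beta> G w v)"
        by (intro sum.cong refl) (simp add: complement_letter[OF G u] algebra_simps)
      also have "\<dots> = (\<Sum>w\<in>pverts G. word_matrix \<beta> G w v) - word_matrix \<beta> G u v
          - (\<Sum>w\<in>pverts G. adjacency_matrix G u w * word_matrix \<beta> G w v)"
        using fin u by (simp add: sum_subtractf)
      also have "(\<Sum>w\<in>pverts G. word_matrix \<beta> G w v)
          = (\<Sum>k\<le>length \<beta>. c k * (row_sum G 0 u * col_sum G k v)) + R G u v"
      proof -
        have "(\<Sum>w\<in>pverts G. word_matrix \<beta> G w v)
          = (\<Sum>w\<in>pverts G. (\<Sum>k\<le>length \<beta>. c k * adj_power G k w v) + Q G w v)"
          by (intro sum.cong refl) (rule IH[OF G])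
        also have "\<dots> = (\<Sum>k\<le>length \<beta>. c k * col_sum G k v) + R G u v"
          unfolding sum.distrib R_eq[OF fin u] col_sum_def sum_distrib_left
          by (subst sum.swap) (rule refl)
        finally show ?thesis using row_sum_0[OF fin u] by simp
      qed
      also have "word_matrix \<beta> G u v
          = (\<Sum>k\<le>Suc (length \<beta>). (if k \<le> length \<beta> then c k else 0) * adj_power G k u v) + Q G u v"
        unfolding IH[OF G u] by simp
      finally show ?thesis
        unfolding adj[OF G] S_def c''_def left_diff_distrib sum_subtractf by (simp add: sum_negf)
    qed
    then show ?thesis using S by blast
  qed
qed

lemma word_trace_form:
  "\<exists>c P. polyfun P \<and> (\<forall>G :: 'a pair_pre_digraph. pair_graph G \<longrightarrow>
     word_trace \<beta> G = (\<Sum>k\<le>length \<beta>. c k * closed_walks G k) + P (walks G))"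
proof -
  obtain c and Q :: "'a pair_pre_digraph \<Rightarrow> 'a \<Rightarrow> 'a \<Rightarrow> real" where Q: "rank_form Q"
    and eq: "\<And>G u v. pair_graph G \<Longrightarrow> u \<in> pverts G \<Longrightarrow>
     word_matrix \<beta> G u v = (\<Sum>k\<le>length \<beta>. c k * adj_power G k u v) + Q G u v"
    using word_matrix_form[of \<beta>] by blast
  obtain P where P: "polyfun P"
    and tr: "\<And>G :: 'a pair_pre_digraph. finite (pverts G) \<Longrightarrow> trace_on (pverts G) (Q G) = P (walks G)"
    using rank_form_trace[OF Q] by blast
  have "word_trace \<beta> G = (\<Sum>k\<le>length \<beta>. c k * closed_walks G k) + P (walks G)"
    if G: "pair_graph G" for G :: "'a pair_pre_digraph"
  proof -
    interpret pair_graph G by fact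
    have "word_trace \<beta> G = (\<Sum>u\<in>pverts G. (\<Sum>k\<le>length \<beta>. c k * adj_power G k u u) + Q G u u)"
      unfolding word_trace_def trace_on_def by (intro sum.cong refl) (rule eq[OF G])
    also have "\<dots> = (\<Sum>u\<in>pverts G. \<Sum>k\<le>length \<beta>. c k * adj_power G k u u) + P (walks G)"
      unfolding sum.distrib using tr[OF pair_finite_verts] by (simp add: trace_on_def)
    also have "(\<Sum>u\<in>pverts G. \<Sum>k\<le>length \<beta>. c k * adj_power G k u u) = (\<Sum>k\<le>length \<beta>. c k * closed_walks G k)"
      unfolding closed_walks_def word_trace_def trace_on_def sum_distrib_left by (rule sum.swap)
    finally show ?thesis .
  qed
  then show ?thesis using P by blast
qed

lemma closed_walks_short:
  assumes "pair_graph G"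
  shows "closed_walks G 0 = walks G 0" and "closed_walks G 1 = 0" and "closed_walks G 2 = walks G 1"
proof -
  interpret pair_graph G by fact
  have fin: "finite (pverts G)" by (rule pair_finite_verts)
  have one: "adj_power G (Suc 0) u v = adjacency_matrix G u v" if "v \<in> pverts G" for u v
  proof -
    have "adj_power G (Suc 0) u v = (\<Sum>w\<in>pverts G. if w = v then adjacency_matrix G u w else 0)"
      unfolding adj_power_Suc by (intro sum.cong refl) (auto simp: mat_id_def)
    then show ?thesis using fin that by simp
  qed
  show "closed_walks G 0 = walks G 0"
    using fin by (simp add: closed_walks_def word_trace_def trace_on_def walks_def row_sum_def mat_id_def)
  show "closed_walks G 1 = 0"
    by (auto dest: no_loops' simp: closed_walks_def word_trace_def trace_on_def one[simplified] adjacency_matrix_def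
        intro!: sum.neutral)
  have sym: "adjacency_matrix G u v * adjacency_matrix G v u = adjacency_matrix G u v" for u v
    using pair_sym_arcs by (auto simp: adjacency_matrix_def dest: arcs_symmetric)
  have "adj_power G 2 u u = row_sum G 1 u" if "u \<in> pverts G" for u
    unfolding numeral_2_eq_2 One_nat_def adj_power_Suc[where k = "Suc 0"] row_sum_def
    by (intro sum.cong refl) (simp only: one[OF that] one sym)
  then show "closed_walks G 2 = walks G 1"
    unfolding closed_walks_def word_trace_def trace_on_def walks_def by (intro sum.cong refl)
qed

lemma trace_space_form:
  fixes \<Phi> :: "'a pair_pre_digraph \<Rightarrow> real"
  assumes "\<Phi> \<in> trace_space"
  obtains N c P where "polyfun P"
    and "\<And>G. pair_graph G \<Longrightarrow> \<Phi> G = (\<Sum>k=3..N. c k * closed_walks G k) + P (walks G)"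
proof -
  obtain W a where W: "finite W" and \<Phi>: "\<And>G. \<Phi> G = (\<Sum>\<beta>\<in>W. a \<beta> * word_trace \<beta> G)"
    using assms unfolding trace_space_iff by blast
  have "\<forall>\<beta>. \<exists>c P. polyfun P \<and> (\<forall>G :: 'a pair_pre_digraph. pair_graph G \<longrightarrow>
     word_trace \<beta> G = (\<Sum>k\<le>length \<beta>. c k * closed_walks G k) + P (walks G))"
    using word_trace_form by blast
  then obtain c P where P: "\<And>\<beta>. polyfun (P \<beta>)"
    and tr: "\<And>\<beta> (G :: 'a pair_pre_digraph). pair_graph G \<Longrightarrow>
     word_trace \<beta> G = (\<Sum>k\<le>length \<beta>. c \<beta> k * closed_walks G k) + P \<beta> (walks G)"
    by metis
  define N where "N = Max (insert 2 (length ` W))"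
  have N: "length \<beta> \<le> N" if "\<beta> \<in> W" for \<beta>
    using W that by (simp add: N_def)
  have "2 \<le> N" using W by (simp add: N_def)
  define d where "d k = (\<Sum>\<beta>\<in>W. a \<beta> * (if k \<le> length \<beta> then c \<beta> k else 0))" for k
  define Q where "Q x = (\<Sum>\<beta>\<in>W. a \<beta> * P \<beta> x) + (d 0 * x 0 + d 2 * x 1)" for x
  have "polyfun Q" unfolding Q_def by (intro polyfun_basic polyfun_sum P)
  moreover have "\<Phi> G = (\<Sum>k=3..N. d k * closed_walks G k) + Q (walks G)" if G: "pair_graph G" for G
  proof -
    have "word_trace \<beta> G = (\<Sum>k\<le>N. (if k \<le> length \<beta> then c \<beta> k else 0) * closed_walks G k) + P \<beta> (walks G)"
      if "\<beta> \<in> W" for \<beta>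
      unfolding tr[OF G] using N[OF that]
      by (intro arg_cong2[where f = "(+)"] refl sum.mono_neutral_cong_left) auto
    then have "\<Phi> G = (\<Sum>\<beta>\<in>W. a \<beta> * ((\<Sum>k\<le>N. (if k \<le> length \<beta> then c \<beta> k else 0) * closed_walks G k) + P \<beta> (walks G)))"
      unfolding \<Phi> by (intro sum.cong) auto
    also have "\<dots> = (\<Sum>\<beta>\<in>W. \<Sum>k\<le>N. a \<beta> * (if k \<le> length \<beta> then c \<beta> k else 0) * closed_walks G k)
        + (\<Sum>\<beta>\<in>W. a \<beta> * P \<beta> (walks G))"
      by (simp only: distrib_left sum.distrib sum_distrib_left mult.assoc)
    also have "(\<Sum>\<beta>\<in>W. \<Sum>k\<le>N. a \<beta> * (if k \<le> length \<beta> then c \<beta> k else 0) * closed_walks G k)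
        = (\<Sum>k\<le>N. d k * closed_walks G k)"
      unfolding d_def sum_distrib_right by (rule sum.swap)
    also have "\<dots> = (\<Sum>k\<in>{0,1,2} \<union> {3..N}. d k * closed_walks G k)"
      using \<open>2 \<le> N\<close> by (intro sum.cong) auto
    also have "\<dots> = d 0 * walks G 0 + d 2 * walks G 1 + (\<Sum>k=3..N. d k * closed_walks G k)"
      by (subst sum.union_disjoint) (auto simp: closed_walks_short[OF G, simplified])
    finally show ?thesis by (simp add: Q_def)
  qed
  ultimately show thesis using that by blast
qed

section \<open>Split graphs with complete bipartite blocks\<close>

text \<open>
  For \<open>a = t\<^sup>3\<close> this is the contribution of a block of size \<open>t\<close> to the moment series, up to the factor
  \<open>t\<^sup>r\<close>.
\<close>

lemma geometric_compose: "(Abs_fps (\<lambda>i. a ^ i) oo symX) = inverse (1 - fps_const a * symX)"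
proof -
  have "(Abs_fps (\<lambda>i. a ^ i) oo symX) * ((1 - fps_const a * fps_X) oo symX) = 1 oo symX"
    by (subst fps_compose_mult_distrib[symmetric]) (simp_all add: geometric_fps)
  also have "(1 - fps_const a * fps_X) oo symX = 1 - fps_const a * symX"
    by (simp add: fps_compose_sub_distrib fps_compose_mult_distrib)
  finally show ?thesis by (intro inverse_fps_unique[symmetric]) simp
qed

lemma move_self_term:
  fixes a b z s g :: "'a :: comm_ring_1"
  assumes "a = b + z * (s - a + g)"
  shows "(1 + z) * a = b + z * (s + g)"
proof -
  have "(1 + z) * a = a + z * a" by (simp add: distrib_right)
  also have "\<dots> = (b + z * (s - a + g)) + z * a" using assms by simp
  also have "\<dots> = b + z * (s + g)" by (simp add: algebra_simps)
  finally show ?thesis .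
qed

lemma move_multiple:
  fixes a r s :: "'a :: comm_ring_1"
  assumes "a = s + r * a"
  shows "(1 - r) * a = s"
proof -
  have "(1 - r) * a = a - r * a" by (simp add: left_diff_distrib)
  also have "\<dots> = s" using assms by (metis add_diff_cancel_right')
  finally show ?thesis .
qed

lemma walk_block_identity:
  fixes z t i f :: "'a :: comm_ring_1"
  assumes "i * (1 + z - z ^ 2 * t ^ 3) = 1"
  shows "z * (t ^ 2 + t ^ 2 * z * (i * (t + z * t * (f + t ^ 2))))
    = z ^ 2 * t ^ 3 * i * (1 + z * f) + z * (t ^ 2 * ((1 + z) * i))"
proof -
  have "z * (t ^ 2 * ((1 + z) * i)) = z * t ^ 2 * (i * (1 + z - z ^ 2 * t ^ 3)) + z ^ 3 * t ^ 5 * i"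
    by (simp add: algebra_simps eval_nat_numeral)
  then show ?thesis unfolding assms by (simp add: algebra_simps eval_nat_numeral)
qed

text \<open>
  The contribution of one block to the trace of \<open>(I - z A)\<^sup>-\<^sup>1\<close>, where \<open>i\<close> is the inverse of the determinant
  of \<open>I - z A\<^sub>0\<close> on the vectors that are constant on both sides of the block, \<open>e = 1/(1 + z)\<close>, and \<open>n\<close> is the factor \<open>1/(1 - clique_series)\<close> that connects the blocks
  through the clique. The coefficient of \<open>n\<close> is \<open>z\<close> times the derivative of \<open>z t i\<close>.
\<close>

lemma trace_block_identity:
  fixes z t i e n :: "'a :: comm_ring_1"
  assumes i: "i * (1 + z - z ^ 2 * t ^ 3) = 1" and e: "e * (1 + z) = 1"
  shows "t * (e * (1 + z * (n * i + t ^ 2 * z * (i * (1 + z * t * (n * i))))))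
      + t ^ 2 * (1 + z * (i * (z * t * (n * (i * (z * t)) + 1))))
    = e * t + t ^ 2 + (e + 1) * (z ^ 2 * t ^ 3 * i) + z * (t * i ^ 2 * (1 + z ^ 2 * t ^ 3)) * n"
proof -
  have "e * z * t * i = e * z * t * i * (i * (1 + z - z ^ 2 * t ^ 3))" unfolding i by simp
  also have "\<dots> = z * t * i ^ 2 * (e * (1 + z)) - e * z ^ 3 * t ^ 4 * i ^ 2"
    by (simp add: algebra_simps eval_nat_numeral)
  finally have key: "e * z * t * i = z * t * i ^ 2 - e * z ^ 3 * t ^ 4 * i ^ 2"
    unfolding e by simp
  have "t * (e * (1 + z * (n * i + t ^ 2 * z * (i * (1 + z * t * (n * i))))))
      + t ^ 2 * (1 + z * (i * (z * t * (n * (i * (z * t)) + 1))))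
    = e * t + t ^ 2 + (e + 1) * (z ^ 2 * t ^ 3 * i)
      + (e * z * t * i + e * z ^ 3 * t ^ 4 * i ^ 2 + z ^ 3 * t ^ 4 * i ^ 2) * n"
    by (simp add: algebra_simps eval_nat_numeral)
  then show ?thesis unfolding key by (simp add: algebra_simps eval_nat_numeral)
qed

lemma deriv_block_identity:
  fixes z t i :: "'a :: comm_ring_1"
  shows "t * i * (i * (1 + z - z ^ 2 * t ^ 3)) + z * t * (- (1 - 2 * z * t ^ 3) * i ^ 2)
    = t * i ^ 2 * (1 + z ^ 2 * t ^ 3)"
  by (simp add: algebra_simps eval_nat_numeral)

text \<open>
  A block \<open>c\<close> has \<open>\<tau> c\<close> clique vertices and \<open>(\<tau> c)\<^sup>2\<close> independent vertices, each of the former joined to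
  each of the latter; the clique vertices of all blocks are pairwise adjacent. The sizes \<open>t\<close> and \<open>t\<^sup>2\<close> make the exponents \<open>3 i + 1\<close>, \<open>3 i\<close> and \<open>3 i + 2\<close> of the relevant
  moments distinct.
\<close>

locale block_split_graph =
  fixes G :: "'a pair_pre_digraph" and K :: "'a set" and block :: "'a \<Rightarrow> 'c"
    and C :: "'c set" and \<tau> :: "'c \<Rightarrow> nat"
  assumes finite_verts: "finite (pverts G)" and finite_C: "finite C"
    and K_subset: "K \<subseteq> pverts G" and block: "v \<in> pverts G \<Longrightarrow> block v \<in> C"
    and card_clique_part: "c \<in> C \<Longrightarrow> card {v \<in> K. block v = c} = \<tau> c"
    and card_indep_part: "c \<in> C \<Longrightarrow> card {v \<in> pverts G - K. block v = c} = \<tau> c ^ 2"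
    and arcs_iff: "u \<in> pverts G \<Longrightarrow> v \<in> pverts G \<Longrightarrow> (u, v) \<in> parcs G \<longleftrightarrow>
      u \<noteq> v \<and> (u \<in> K \<and> v \<in> K \<or> (u \<in> K \<longleftrightarrow> v \<notin> K) \<and> block u = block v)"
begin

abbreviation "clique_part c \<equiv> {v \<in> K. block v = c}"
abbreviation "indep_part c \<equiv> {v \<in> pverts G - K. block v = c}"
abbreviation "T c \<equiv> (of_nat (\<tau> c) :: real fps)"

definition moment :: "nat \<Rightarrow> real" where
  "moment j = (\<Sum>c\<in>C. real (\<tau> c) ^ j)"

definition inv_D :: "'c \<Rightarrow> real fps" where
  "inv_D c = inverse (1 + fps_X - fps_X ^ 2 * T c ^ 3)"

lemma inv_D_mult: "inv_D c * (1 + fps_X - fps_X ^ 2 * T c ^ 3) = 1"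
  unfolding inv_D_def by (rule inverse_mult_eq_1) simp

lemma finite_parts: "finite K" "finite (clique_part c)" "finite (indep_part c)"
proof -
  show "finite K" using K_subset finite_verts by (rule finite_subset)
  then show "finite (clique_part c)" by simp
  show "finite (indep_part c)" using finite_verts by simp
qed

lemma sum_K: "sum f K = (\<Sum>c\<in>C. sum f (clique_part c))"
  by (rule sum.group[symmetric]) (use finite_parts finite_C block K_subset in auto)

lemma sum_I: "sum f (pverts G - K) = (\<Sum>c\<in>C. sum f (indep_part c))"
  by (rule sum.group[symmetric]) (use finite_verts finite_C block in auto)

lemma sum_verts: "sum f (pverts G) = (\<Sum>c\<in>C. sum f (clique_part c)) + (\<Sum>c\<in>C. sum f (indep_part c))"
  unfolding sum_K[symmetric] sum_I[symmetric]
  using sum.subset_diff[OF K_subset finite_verts, of f] by (simp add: add.commute)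

lemma moment_series_moment: "moment_series r moment = (\<Sum>c\<in>C. T c ^ r * ((1 + fps_X) * inv_D c))"
proof -
  have "(1 + fps_X) * inv_D c = inverse (1 - fps_const (real (\<tau> c) ^ 3) * symX)" for c
  proof (rule inverse_fps_unique[symmetric])
    have "(1 + fps_X) * inv_D c * (1 - fps_const (real (\<tau> c) ^ 3) * symX)
        = inv_D c * (1 + fps_X - symX * (1 + fps_X) * T c ^ 3)"
      by (simp only: algebra_simps mult_1_left mult_1_right fps_const_power[symmetric] fps_of_nat)
    also have "\<dots> = 1" unfolding symX_mult by (rule inv_D_mult)
    finally show "(1 + fps_X) * inv_D c * (1 - fps_const (real (\<tau> c) ^ 3) * symX) = 1" .
  qed
  then have Q: "Abs_fps (\<lambda>i. (real (\<tau> c) ^ 3) ^ i) oo symX = (1 + fps_X) * inv_D c" for c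
    unfolding geometric_compose by simp
  have "Abs_fps (\<lambda>i. moment (3 * i + r))
      = (\<Sum>c\<in>C. fps_const (real (\<tau> c) ^ r) * Abs_fps (\<lambda>i. (real (\<tau> c) ^ 3) ^ i))"
    by (rule fps_ext, simp add: moment_def fps_sum_nth power_add power_mult, simp only: mult.commute)
  then have "moment_series r moment = (\<Sum>c\<in>C. fps_const (real (\<tau> c) ^ r) * ((1 + fps_X) * inv_D c))"
    unfolding moment_series_def
    by (simp only: fps_compose_sum_distrib fps_compose_mult_distrib[OF symX_nth_0] fps_const_compose Q)
  then show ?thesis by (simp only: fps_const_power[symmetric] fps_of_nat)
qed

lemma clique_series_moment: "clique_series moment = (\<Sum>c\<in>C. fps_X * T c * inv_D c)"
proof -
  have "clique_series moment = (\<Sum>c\<in>C. fps_X * T c * inv_D c * (recip1X * (1 + fps_X)))"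
    unfolding clique_series_def moment_series_moment sum_distrib_left by (simp only: mult_ac power_one_right)
  then show ?thesis unfolding recip1X_mult by simp
qed

lemma excursion_series_moment: "excursion_series moment = (\<Sum>c\<in>C. fps_X ^ 2 * T c ^ 3 * inv_D c)"
proof -
  have "excursion_series moment = (\<Sum>c\<in>C. symX * (1 + fps_X) * T c ^ 3 * inv_D c)"
    unfolding excursion_series_def moment_series_moment sum_distrib_left by (simp only: mult_ac)
  then show ?thesis unfolding symX_mult .
qed

text \<open>
  Walks with a weight \<open>y\<close> at their last vertex, counted by their first vertex, satisfy
  \<open>x = y + z A x\<close>. In a block split graph this system is solved by its sums over the parts. The choice
  \<open>y = 1\<close> counts all walks, and the choice \<open>y = \<delta>\<^sub>v\<close> yields the diagonal of \<open>(I - z A)\<^sup>-\<^sup>1\<close>.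
\<close>

context
  fixes x y :: "'a \<Rightarrow> real fps"
  assumes walk_eq: "u \<in> pverts G \<Longrightarrow>
    x u = y u + fps_X * (\<Sum>w\<in>pverts G. fps_const (adjacency_matrix G u w) * x w)"
begin

lemma neighbour_sum_K:
  assumes "u \<in> clique_part c"
  shows "(1 + fps_X) * x u = y u + fps_X * (sum x K + sum x (indep_part c))"
proof -
  have u: "u \<in> pverts G" "u \<in> K" using assms K_subset by auto
  have "(\<Sum>w\<in>pverts G. fps_const (adjacency_matrix G u w) * x w)
      = (\<Sum>w\<in>pverts G. if w \<in> (K - {u}) \<union> indep_part c then x w else 0)"
    using u assms by (intro sum.cong refl) (auto simp: adjacency_matrix_def arcs_iff)
  also have "\<dots> = sum x ((K - {u}) \<union> indep_part c)"
    using K_subset finite_verts by (subst sum.inter_restrict[symmetric]) (auto intro!: sum.cong)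
  also have "\<dots> = sum x (K - {u}) + sum x (indep_part c)"
    using finite_parts by (intro sum.union_disjoint) auto
  also have "sum x (K - {u}) = sum x K - x u"
    using finite_parts u by (simp add: sum_diff1)
  finally have "x u = y u + fps_X * (sum x K - x u + sum x (indep_part c))"
    using walk_eq[OF u(1)] by simp
  then show ?thesis by (rule move_self_term)
qed

lemma neighbour_sum_I:
  assumes "u \<in> indep_part c"
  shows "x u = y u + fps_X * sum x (clique_part c)"
proof -
  have u: "u \<in> pverts G" "u \<notin> K" using assms by auto
  have "(\<Sum>w\<in>pverts G. fps_const (adjacency_matrix G u w) * x w)
      = (\<Sum>w\<in>pverts G. if w \<in> clique_part c then x w else 0)"
    using u assms by (intro sum.cong refl) (auto simp: adjacency_matrix_def arcs_iff)
  also have "\<dots> = sum x (clique_part c)"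
    using K_subset finite_verts by (subst sum.inter_restrict[symmetric]) (auto intro!: sum.cong)
  finally show ?thesis using walk_eq[OF u(1)] by simp
qed

lemma indep_total: "c \<in> C \<Longrightarrow> sum x (indep_part c) = sum y (indep_part c) + T c ^ 2 * fps_X * sum x (clique_part c)"
proof -
  assume c: "c \<in> C"
  have "sum x (indep_part c) = (\<Sum>u\<in>indep_part c. y u + fps_X * sum x (clique_part c))"
    by (intro sum.cong refl neighbour_sum_I)
  then show ?thesis using card_indep_part[OF c] by (simp add: sum.distrib mult.assoc)
qed

lemma clique_total:
  assumes c: "c \<in> C"
  shows "sum x (clique_part c) = inv_D c * (sum y (clique_part c) + fps_X * T c * (sum x K + sum y (indep_part c)))"
proof -
  have "(1 + fps_X) * sum x (clique_part c) = (\<Sum>u\<in>clique_part c. y u + fps_X * (sum x K + sum x (indep_part c)))"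
    unfolding sum_distrib_left by (intro sum.cong refl neighbour_sum_K)
  also have "\<dots> = sum y (clique_part c) + T c * (fps_X * (sum x K + sum x (indep_part c)))"
    using card_clique_part[OF c] by (simp add: sum.distrib)
  also have "\<dots> = sum y (clique_part c) + fps_X * T c * (sum x K + sum y (indep_part c)) + fps_X ^ 2 * T c ^ 3 * sum x (clique_part c)"
    unfolding indep_total[OF c] by (simp only: algebra_simps power2_eq_square power3_eq_cube)
  finally have "(1 + fps_X - fps_X ^ 2 * T c ^ 3) * sum x (clique_part c)
      = sum y (clique_part c) + fps_X * T c * (sum x K + sum y (indep_part c))"
    unfolding left_diff_distrib by simp
  then have "inv_D c * (1 + fps_X - fps_X ^ 2 * T c ^ 3) * sum x (clique_part c)
      = inv_D c * (sum y (clique_part c) + fps_X * T c * (sum x K + sum y (indep_part c)))"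
    by (simp only: mult.assoc)
  then show ?thesis unfolding inv_D_mult by simp
qed

text \<open>
  Different blocks interact only through the clique total, so elimination of the blocks leaves one
  scalar equation for it.
\<close>

lemma total_on_clique:
  "sum x K = inverse (1 - clique_series moment) * (\<Sum>c\<in>C. inv_D c * (sum y (clique_part c) + fps_X * T c * sum y (indep_part c)))"
proof -
  let ?S = "\<Sum>c\<in>C. inv_D c * (sum y (clique_part c) + fps_X * T c * sum y (indep_part c))"
  have "sum x K = (\<Sum>c\<in>C. inv_D c * (sum y (clique_part c) + fps_X * T c * (sum x K + sum y (indep_part c))))"
    unfolding sum_K[of x] by (intro sum.cong refl) (simp only: clique_total sum_K)
  also have "\<dots> = ?S + (\<Sum>c\<in>C. fps_X * T c * inv_D c) * sum x K"
    unfolding sum_distrib_right sum.distrib[symmetric] by (intro sum.cong refl) (simp only: algebra_simps)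
  finally have "(1 - clique_series moment) * sum x K = ?S"
    unfolding clique_series_moment by (rule move_multiple)
  then have "inverse (1 - clique_series moment) * (1 - clique_series moment) * sum x K = inverse (1 - clique_series moment) * ?S"
    by (simp only: mult.assoc)
  moreover have "inverse (1 - clique_series moment) * (1 - clique_series moment) = 1"
    by (rule inverse_mult_eq_1) simp
  ultimately show ?thesis by simp
qed

end

lemma walks_series: "1 + fps_X * Abs_fps (walks G) = walk_series moment"
proof -
  define x where "x u = Abs_fps (\<lambda>k. row_sum G k u)" for u
  have eq: "x u = 1 + fps_X * (\<Sum>w\<in>pverts G. fps_const (adjacency_matrix G u w) * x w)"
    if "u \<in> pverts G" for u
  proof (rule fps_ext)
    fix k show "x u $ k = (1 + fps_X * (\<Sum>w\<in>pverts G. fps_const (adjacency_matrix G u w) * x w)) $ k"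
      using row_sum_0[OF finite_verts that]
      by (cases k) (simp_all add: x_def fps_sum_nth adj_mult_row_sum)
  qed
  let ?F = "sum x K" and ?z = "fps_X :: real fps"
  let ?N = "inverse (1 - clique_series moment)"
  have Y: "c \<in> C \<Longrightarrow> (\<Sum>u\<in>clique_part c. 1) = T c" and Z: "c \<in> C \<Longrightarrow> (\<Sum>u\<in>indep_part c. 1) = T c ^ 2" for c
    using card_clique_part card_indep_part by simp_all
  have N: "?N * (1 - clique_series moment) = 1" by (rule inverse_mult_eq_1) simp
  have "?F = ?N * (\<Sum>c\<in>C. inv_D c * (T c + ?z * T c * T c ^ 2))"
    using total_on_clique[of x "\<lambda>_. 1", OF eq] by (simp only: Y Z cong: sum.cong)
  then have "?z * ?F = ?z * (?N * (\<Sum>c\<in>C. inv_D c * (T c + ?z * T c * T c ^ 2)))"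
    by (rule arg_cong)
  also have "\<dots> = ?N * (\<Sum>c\<in>C. ?z * T c * inv_D c + ?z ^ 2 * T c ^ 3 * inv_D c)"
    unfolding sum_distrib_left by (simp only: algebra_simps power2_eq_square power3_eq_cube)
  also have "\<dots> = ?N * (1 + excursion_series moment - (1 - clique_series moment))"
    unfolding sum.distrib clique_series_moment[symmetric] excursion_series_moment[symmetric] by simp
  also have "\<dots> = (1 + excursion_series moment) * ?N - 1"
    using N by (simp only: right_diff_distrib mult.commute)
  finally have F: "1 + ?z * ?F = (1 + excursion_series moment) * ?N" by simp
  have "Abs_fps (walks G) = sum x (pverts G)"
    by (rule fps_ext) (simp add: x_def fps_sum_nth walks_def)
  also have "\<dots> = ?F + (\<Sum>c\<in>C. sum x (indep_part c))"
    by (simp only: sum_verts sum_K)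
  also have "(\<Sum>c\<in>C. sum x (indep_part c)) = (\<Sum>c\<in>C. T c ^ 2 + T c ^ 2 * ?z * (inv_D c * (T c + ?z * T c * (?F + T c ^ 2))))"
    by (intro sum.cong refl)
      (simp only: indep_total[of x "\<lambda>_. 1", OF eq] clique_total[of x "\<lambda>_. 1", OF eq] Y Z)
  finally have "?z * Abs_fps (walks G)
      = ?z * ?F + (\<Sum>c\<in>C. ?z * (T c ^ 2 + T c ^ 2 * ?z * (inv_D c * (T c + ?z * T c * (?F + T c ^ 2)))))"
    by (simp only: distrib_left sum_distrib_left)
  also have "(\<Sum>c\<in>C. ?z * (T c ^ 2 + T c ^ 2 * ?z * (inv_D c * (T c + ?z * T c * (?F + T c ^ 2)))))
      = (\<Sum>c\<in>C. ?z ^ 2 * T c ^ 3 * inv_D c * (1 + ?z * ?F) + ?z * (T c ^ 2 * ((1 + ?z) * inv_D c)))"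
    by (intro sum.cong refl walk_block_identity inv_D_mult)
  also have "\<dots> = excursion_series moment * (1 + ?z * ?F) + ?z * moment_series 2 moment"
    unfolding sum.distrib excursion_series_moment moment_series_moment sum_distrib_left sum_distrib_right ..
  finally have W: "?z * Abs_fps (walks G) = ?z * ?F + (excursion_series moment * (1 + ?z * ?F) + ?z * moment_series 2 moment)" .
  have "1 + ?z * Abs_fps (walks G) = (1 + excursion_series moment) * (1 + ?z * ?F) + ?z * moment_series 2 moment"
    unfolding W by (simp only: distrib_right mult_1_left add.assoc)
  then show ?thesis
    unfolding walk_series_def F power2_eq_square by (simp only: mult.assoc)
qed

lemma deriv_clique_series_moment: "fps_deriv (clique_series moment) = (\<Sum>c\<in>C. T c * inv_D c ^ 2 * (1 + fps_X ^ 2 * T c ^ 3))"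
  unfolding clique_series_moment fps_deriv_sum
proof (intro sum.cong refl)
  fix c
  let ?z = "fps_X :: real fps"
  define D where "D = 1 + ?z - ?z ^ 2 * T c ^ 3"
  have T: "fps_deriv (T c) = 0" by (simp flip: fps_of_nat)
  have D: "fps_deriv D = 1 - 2 * ?z * T c ^ 3"
    by (simp add: D_def T fps_deriv_power numeral_fps_const)
  have I: "fps_deriv (inv_D c) = - (1 - 2 * ?z * T c ^ 3) * inv_D c ^ 2"
    unfolding inv_D_def D_def[symmetric] D[symmetric] by (rule fps_inverse_deriv) (simp add: D_def)
  have "fps_deriv (?z * T c * inv_D c) = T c * inv_D c * (inv_D c * (1 + ?z - ?z ^ 2 * T c ^ 3))
      + ?z * T c * (- (1 - 2 * ?z * T c ^ 3) * inv_D c ^ 2)"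
    unfolding inv_D_mult by (simp add: T I)
  also have "\<dots> = T c * inv_D c ^ 2 * (1 + ?z ^ 2 * T c ^ 3)"
    by (rule deriv_block_identity)
  finally show "fps_deriv (?z * T c * inv_D c) = T c * inv_D c ^ 2 * (1 + ?z ^ 2 * T c ^ 3)" .
qed

lemma closed_walks_series: "Abs_fps (closed_walks G) = trace_series moment"
proof -
  define x where "x v u = Abs_fps (\<lambda>k. adj_power G k u v)" for v u
  define y where "y v u = (if u = v then 1 else 0 :: real fps)" for v u :: 'a
  have eq: "x v u = y v u + fps_X * (\<Sum>w\<in>pverts G. fps_const (adjacency_matrix G u w) * x v w)" for u v
  proof (rule fps_ext)
    fix k show "x v u $ k = (y v u + fps_X * (\<Sum>w\<in>pverts G. fps_const (adjacency_matrix G u w) * x v w)) $ k"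
      by (cases k) (simp_all add: x_def y_def fps_sum_nth adj_power_Suc mat_id_def del: replicate.simps(2) word_matrix.simps(2))
  qed
  let ?z = "fps_X :: real fps" and ?N = "inverse (1 - clique_series moment)"
  have on_clique: "x v v = recip1X * (1 + ?z * (?N * inv_D c + T c ^ 2 * ?z * (inv_D c * (1 + ?z * T c * (?N * inv_D c)))))"
    if v: "v \<in> clique_part c" for v c
  proof -
    have c: "c \<in> C" using v block K_subset by auto
    have Y: "sum (y v) (clique_part d) = (if d = c then 1 else 0)" for d
      using v finite_parts by (auto simp: y_def)
    have Z: "sum (y v) (indep_part d) = 0" for d
      using v by (auto simp: y_def intro!: sum.neutral)
    have F: "sum (x v) K = ?N * inv_D c"
    proof -
      have "(\<Sum>d\<in>C. inv_D d * ((if d = c then 1 else 0) + ?z * T d * 0)) = (\<Sum>d\<in>C. if d = c then inv_D c else 0)"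
        by (intro sum.cong) auto
      also have "\<dots> = inv_D c" using finite_C c by simp
      finally show ?thesis unfolding total_on_clique[of "x v" "y v", OF eq] Y Z by simp
    qed
    have "(1 + ?z) * x v v = y v v + ?z * (sum (x v) K + sum (x v) (indep_part c))"
      by (rule neighbour_sum_K[of "x v" "y v", OF eq v])
    also have "\<dots> = 1 + ?z * (?N * inv_D c + T c ^ 2 * ?z * (inv_D c * (1 + ?z * T c * (?N * inv_D c))))"
      unfolding indep_total[of "x v" "y v", OF eq c] clique_total[of "x v" "y v", OF eq c] Y Z F
      by (simp add: y_def)
    finally have "recip1X * (1 + ?z) * x v v
        = recip1X * (1 + ?z * (?N * inv_D c + T c ^ 2 * ?z * (inv_D c * (1 + ?z * T c * (?N * inv_D c)))))"
      by (simp only: mult.assoc)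
    then show ?thesis unfolding recip1X_mult by simp
  qed
  have on_indep: "x v v = 1 + ?z * (inv_D c * (?z * T c * (?N * (inv_D c * (?z * T c)) + 1)))"
    if v: "v \<in> indep_part c" for v c
  proof -
    have c: "c \<in> C" using v block by auto
    have Y: "sum (y v) (clique_part d) = 0" for d
      using v by (auto simp: y_def intro!: sum.neutral)
    have Z: "sum (y v) (indep_part d) = (if d = c then 1 else 0)" for d
      using v finite_parts by (auto simp: y_def)
    have F: "sum (x v) K = ?N * (inv_D c * (?z * T c))"
    proof -
      have "(\<Sum>d\<in>C. inv_D d * (0 + ?z * T d * (if d = c then 1 else 0))) = (\<Sum>d\<in>C. if d = c then inv_D c * (?z * T c) else 0)"
        by (intro sum.cong) auto
      also have "\<dots> = inv_D c * (?z * T c)" using finite_C c by simp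
      finally show ?thesis unfolding total_on_clique[of "x v" "y v", OF eq] Y Z by simp
    qed
    have "x v v = y v v + ?z * sum (x v) (clique_part c)"
      by (rule neighbour_sum_I[of "x v" "y v", OF eq v])
    then show ?thesis
      unfolding clique_total[of "x v" "y v", OF eq c] Y Z F by (simp add: y_def)
  qed
  have "Abs_fps (closed_walks G) = (\<Sum>v\<in>pverts G. x v v)"
    by (rule fps_ext) (simp add: x_def fps_sum_nth closed_walks_def word_trace_def trace_on_def)
  also have "\<dots> = (\<Sum>c\<in>C. (\<Sum>v\<in>clique_part c. x v v) + (\<Sum>v\<in>indep_part c. x v v))"
    unfolding sum_verts sum.distrib ..
  also have "\<dots> = (\<Sum>c\<in>C. recip1X * T c + T c ^ 2 + (recip1X + 1) * (?z ^ 2 * T c ^ 3 * inv_D c)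
      + ?z * (T c * inv_D c ^ 2 * (1 + ?z ^ 2 * T c ^ 3)) * ?N)"
  proof (rule sum.cong[OF refl])
    fix c assume c: "c \<in> C"
    have "(\<Sum>v\<in>clique_part c. x v v) + (\<Sum>v\<in>indep_part c. x v v)
        = T c * (recip1X * (1 + ?z * (?N * inv_D c + T c ^ 2 * ?z * (inv_D c * (1 + ?z * T c * (?N * inv_D c))))))
          + T c ^ 2 * (1 + ?z * (inv_D c * (?z * T c * (?N * (inv_D c * (?z * T c)) + 1))))"
      using card_clique_part[OF c] card_indep_part[OF c]
      by (simp only: on_clique on_indep sum_constant of_nat_power cong: sum.cong)
    then show "(\<Sum>v\<in>clique_part c. x v v) + (\<Sum>v\<in>indep_part c. x v v)
        = recip1X * T c + T c ^ 2 + (recip1X + 1) * (?z ^ 2 * T c ^ 3 * inv_D c)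
          + ?z * (T c * inv_D c ^ 2 * (1 + ?z ^ 2 * T c ^ 3)) * ?N"
      unfolding trace_block_identity[OF inv_D_mult recip1X_mult] .
  qed
  also have "\<dots> = recip1X * (\<Sum>c\<in>C. T c) + (\<Sum>c\<in>C. T c ^ 2) + (recip1X + 1) * excursion_series moment
      + ?z * fps_deriv (clique_series moment) * ?N"
    unfolding deriv_clique_series_moment excursion_series_moment sum_distrib_left sum_distrib_right sum.distrib ..
  also have "(\<Sum>c\<in>C. T c) = fps_const (moment 1)"
    by (rule fps_ext) (simp add: moment_def fps_sum_nth flip: fps_of_nat)
  also have "(\<Sum>c\<in>C. T c ^ 2) = fps_const (moment 2)"
    by (rule fps_ext) (simp add: moment_def fps_sum_nth flip: fps_of_nat)
  also have "recip1X + 1 = (2 + ?z) * recip1X"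
  proof -
    have "recip1X + 1 = recip1X + recip1X * (1 + ?z)" unfolding recip1X_mult ..
    then show ?thesis by (simp add: algebra_simps)
  qed
  finally show ?thesis unfolding trace_series_def by (simp only: mult.commute)
qed

end

section \<open>Vanishing on split graphs implies vanishing\<close>

text \<open>
  The vertices are labelled by the block \<open>(t, i)\<close>, the side and a number; this countable set of labels
  embeds into every infinite type.
\<close>

lemma block_split_graph_exists:
  fixes n :: "nat \<Rightarrow> nat"
  obtains G :: "'a :: infinite pair_pre_digraph" and K block
  where "block_split_graph G K block (SIGMA t:{..D}. {..<n t}) fst"
    and "pair_graph G"
    and "pverts G \<noteq> {} \<Longrightarrow> split_graph G"
proof -
  obtain f :: "nat \<Rightarrow> 'a" where f: "inj f"
    using infinite_countable_subset[OF infinite_UNIV] by blast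
  define h :: "(nat \<times> nat) \<times> bool \<times> nat \<Rightarrow> 'a" where "h = f \<circ> to_nat"
  have h: "inj h" unfolding h_def by (intro inj_compose f inj_to_nat)
  have inv [simp]: "inv h (h x) = x" for x using h by simp
  have h_eq [simp]: "h x = h y \<longleftrightarrow> x = y" for x y using h by (simp add: inj_eq)
  define C where "C = (SIGMA t:{..D}. {..<n t})"
  define V where "V = h ` (SIGMA c:C. ({True} \<times> {..<fst c}) \<union> ({False} \<times> {..<fst c ^ 2}))"
  define K where "K = {v \<in> V. fst (snd (inv h v))}"
  define block where "block v = fst (inv h v)" for v
  define G where "G = \<lparr>pverts = V, parcs = {(u, v). u \<in> V \<and> v \<in> V \<and> u \<noteq> v \<and>
      (u \<in> K \<and> v \<in> K \<or> (u \<in> K \<longleftrightarrow> v \<notin> K) \<and> block u = block v)}\<rparr>"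
  have fin: "finite C" "finite V" unfolding V_def C_def by auto
  have "block_split_graph G K block C fst"
  proof
    fix c assume c: "c \<in> C"
    have "{v \<in> K. block v = c} = h ` ({c} \<times> {True} \<times> {..<fst c})"
      using c by (auto simp: K_def V_def block_def)
    then show "card {v \<in> K. block v = c} = fst c"
      using h by (simp add: card_image inj_on_subset card_cartesian_product)
    have "{v \<in> pverts G - K. block v = c} = h ` ({c} \<times> {False} \<times> {..<fst c ^ 2})"
      using c by (auto simp: K_def V_def block_def G_def)
    then show "card {v \<in> pverts G - K. block v = c} = fst c ^ 2"
      using h by (simp add: card_image inj_on_subset card_cartesian_product)
  qed (use fin in \<open>auto simp: G_def K_def V_def block_def\<close>)
  moreover have pg: "pair_graph G"
  proof
    have "parcs G \<subseteq> V \<times> V" by (auto simp: G_def)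
    then show "finite (parcs G)" by (rule finite_subset) (use fin in simp)
    have "symmetric (with_proj G) \<longleftrightarrow> sym (parcs G)" by (simp add: symmetric_def)
    then show "symmetric (with_proj G)" by (auto simp: G_def sym_def)
  qed (use fin in \<open>auto simp: G_def\<close>)
  moreover have "split_graph G" if "pverts G \<noteq> {}"
    unfolding split_graph_def nonempty_graph_def
  proof (intro conjI pg that exI)
    show "pverts G = K \<union> (V - K)" by (auto simp: G_def K_def)
    show "K \<inter> (V - K) = {}" by auto
    show "is_clique G K" by (auto simp: is_clique_def G_def K_def)
    show "is_independent G (V - K)" by (auto simp: is_independent_def G_def)
  qed
  ultimately show thesis using that unfolding C_def by blast
qed

lemma trace_space_empty:
  assumes "\<Phi> \<in> trace_space" and "pverts G = {}"
  shows "\<Phi> G = 0"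
  using assms by (auto simp: trace_space_iff word_trace_def trace_on_def)

theorem theorem6p3:
  fixes \<Phi> :: "'a::infinite pair_pre_digraph \<Rightarrow> real"
  assumes "\<Phi> \<in> trace_space"
    and "\<forall>S. split_graph S \<longrightarrow> \<Phi> S = 0"
  shows "\<forall>G. nonempty_graph G \<longrightarrow> \<Phi> G = 0"
proof (intro allI impI)
  fix G :: "'a pair_pre_digraph" assume "nonempty_graph G"
  then have G: "pair_graph G" by (simp add: nonempty_graph_def)
  obtain N c P where P: "polyfun P"
    and \<Phi>: "\<And>H. pair_graph H \<Longrightarrow> \<Phi> H = (\<Sum>k=3..N. c k * closed_walks H k) + P (walks H)"
    by (rule trace_space_form[OF assms(1)]) (rule that)
  define \<Psi> where "\<Psi> \<rho> = (\<Sum>k=3..N. c k * trace_series \<rho> $ k) + P (\<lambda>k. walk_series \<rho> $ Suc k)" for \<rho>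
  have poly_\<Psi>: "polyfun \<Psi>"
    unfolding \<Psi>_def using polyfun_trace_series polyfun_walk_series
    by (intro polyfun_add polyfun_sum polyfun_mult polyfun_const polyfun_compose[OF P])
      (simp_all add: polyfun_fps_def)
  have "\<Psi> (\<lambda>j. \<Sum>t\<le>D. real (n t) * real t ^ j) = 0" for D n
  proof -
    obtain S :: "'a pair_pre_digraph" and K block
      where block: "block_split_graph S K block (SIGMA t:{..D}. {..<n t}) fst"
        and S: "pair_graph S" and split: "pverts S \<noteq> {} \<Longrightarrow> split_graph S"
      by (rule block_split_graph_exists[of D n]) (rule that)
    interpret block_split_graph S K block "SIGMA t:{..D}. {..<n t}" fst by (rule block)
    \<comment> \<open>There are \<open>n t\<close> blocks of each size \<open>t \<le> D\<close>.\<close>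
    have moment: "moment = (\<lambda>j. \<Sum>t\<le>D. real (n t) * real t ^ j)"
    proof
      fix j
      show "moment j = (\<Sum>t\<le>D. real (n t) * real t ^ j)"
        using sum.Sigma[of "{..D}" "\<lambda>t. {..<n t}" "\<lambda>t i. real t ^ j"]
        by (simp add: moment_def split_def)
    qed
    have "closed_walks S k = trace_series moment $ k" for k
      using closed_walks_series by (metis fps_nth_Abs_fps)
    moreover have "walks S = (\<lambda>k. walk_series moment $ Suc k)"
      by (rule ext) (simp flip: walks_series)
    ultimately have "\<Psi> moment = \<Phi> S"
      unfolding \<Psi>_def \<Phi>[OF S] by simp
    \<comment> \<open>If all blocks are empty, the graph has no vertices and all traces vanish.\<close>
    also have "\<dots> = 0"
      using assms(2) split trace_space_empty[OF assms(1)] by (cases "pverts S = {}") auto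
    finally show ?thesis unfolding moment .
  qed
  then have zero: "\<Psi> \<rho> = 0" for \<rho>
    by (rule polyfun_zero_if_zero_on_power_sums[OF poly_\<Psi>])
  obtain R \<rho> where R: "R $ 0 = 1" and \<rho>1: "\<And>p. \<rho> p 1 = p"
    and walk: "\<And>p. walk_series (\<rho> p) = 1 + fps_X * Abs_fps (walks G)"
    and th: "\<And>p. excursion_series (\<rho> p) = (R * sqrt_linear (p * (p - 1)) oo symX) - 1"
    and al: "\<And>p. clique_series (\<rho> p) = fps_const p * fps_X * recip1X"
    using prescribed_walk_series[of "1 + fps_X * Abs_fps (walks G)"] by auto
  have "(\<Sum>k=3..N. c k * trace_series (\<rho> (real n)) $ k) = - P (walks G)" for n
    using zero[of "\<rho> (real n)"] unfolding \<Psi>_def walk by simp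
  moreover have "(\<lambda>n. trace_series (\<rho> (real n)) $ k / real n ^ k) \<longlonglongrightarrow> trace_lead k" if "3 \<le> k" for k
    using that by (intro trace_series_asymptotics[OF R th al \<rho>1]) simp
  ultimately have c: "c k = 0" if "k \<in> {3..N}" for k
    using leading_terms_independent[where N = N and c = c and l = trace_lead
        and T = "\<lambda>k n. trace_series (\<rho> (real n)) $ k"] trace_lead_nonzero that
    by blast
  \<comment> \<open>Any member of the family shows this, for instance \<open>p = 0\<close>.\<close>
  then have "P (walks G) = 0"
    using zero[of "\<rho> 0"] unfolding \<Psi>_def walk by simp
  then show "\<Phi> G = 0" unfolding \<Phi>[OF G] using c by simp
qed

end
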